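(* Let $R\ge2$ be the order of expansion of the time discretization error, and let $$\mathcal{E}(R,N):=\min_{\frac{R(R+1)}{2}\times n\times M=N}\sqrt{\frac{\mathrm{Var}(f(X_T))}{M}\,(1+\varepsilon(n))+\frac{\widetilde c_R^{\,2}}{n^{2R}}\,(1+O(1/n))},\qquad \lim_n\varepsilon(n)=0.$$ (a) Then $$\lim_{N\to\infty}N^{\frac12\left(1-\frac{1}{2R+1}\right)}\mathcal{E}(R,N)=\frac{1}{\sqrt2}\times\Theta(R)\times R\,|\widetilde c_R|^{\frac{1}{2R+1}}\times\big(\mathrm{Var}(f(X_T))\big)^{\frac{R}{2R+1}},$$ where $$\Theta(R)=2^{\frac{1}{2(2R+1)}}R^{-\frac{1}{2R+1}}\Big(1+\frac1R\Big)^{\frac{R}{2R+1}}\Big((2R)^{-\frac{2R}{2R+1}}+(2R)^{\frac{1}{2R+1}}\Big)^{\frac12}\longrightarrow1\quad\text{as }R\to\infty.$$ (b) Furthermore, for a fixed complexity level $N$, the solution $(n(N),M(N))$ of the minimization problem satisfies $$M(N)\sim\frac{2}{R(R+1)}\Big(\frac{R+1}{4}\Big)^{\frac{1}{2R+1}}\Big(\frac{\mathrm{Var}(f(X_T))}{\widetilde c_R^{\,2}}\Big)^{\frac{1}{2R+1}}N^{\frac{2R}{2R+1}}$$ and $$n(N)\sim\Big(\frac{R+1}{4}\Big)^{-\frac{1}{2R+1}}\Big(\frac{\widetilde c_R^{\,2}}{\mathrm{Var}(f(X_T))}\Big)^{\frac{1}{2R+1}}N^{\frac{1}{2R+1}}$$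 as $N\to\infty$, so that $$M(N)\sim\frac{1}{2R}\,\frac{\mathrm{Var}(f(X_T))}{\widetilde c_R^{\,2}}\,n(N)^{2R}.$$
   Context: $X$ is the solution of the SDE $dX_t=b(t,X_t)dt+\sigma(t,X_t)dW_t$, $X_0=x\in\mathbb{R}^d$, on $[0,T]$. For $r=1,\dots,R$, $\bar X^{(r)}$ is its Euler scheme with step $\frac{T}{rn}$, all schemes being built from the increments of the same Brownian motion $W$ (consistent Brownian increments). One sets $\alpha_r=(-1)^{R-r}\frac{r^R}{r!(R-r)!}$, $1\le r\le R$. The function $f:\mathbb{R}^d\to\mathbb{R}$ is such that the weak error has an expansion $\mathbb{E}f(X_T)=\mathbb{E}f(\bar X_T)+\sum_{k=1}^{R}\frac{c_k}{n^k}+O(n^{-(R+1)})$ for the Euler scheme $\bar X$ with step $T/n$, where the real constants $c_k$ do not depend on $n$, and such that $\mathrm{Var}\big(\sum_{r=1}^R\alpha_rf(\bar X^{(r)}_T)\big)\to\mathrm{Var}(f(X_T))$ as $n\to\infty$. One sets $\widetilde c_R:=c_R\sum_{r=1}^R\frac{\alpha_r}{r^R}$. Here $\mathrm{Var}(f(X_T))>0$ and $\widetilde c_R\neq0$. The quantity under the square root is the squared $L^2$-error of the Monte Carlo estimator of $\mathbb{E}f(X_T)$ that averages $M$ independent copies of $\sum_{r=1}^R\alpha_rf(\bar X^{(r)}_T)$: $$\Big\|\mathbb{E}f(X_T)-\frac1M\sum_{m=1}^M\sum_{r=1}^R\alpha_rf\big((\bar X^{(r)}_T)^m\big)\Big\|_2^2=\frac{\mathrm{Var}(f(X_T))}{M}(1+\varepsilon(n))+\frac{\widetilde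 c_R^{\,2}}{n^{2R}}(1+O(1/n)).$$ Its complexity, normalized so that the computation of one time step of an Euler scheme has cost $1$, is $N=\frac{R(R+1)}{2}\times n\times M$, where $n$ is the time discretization parameter and $M$ the size of the Monte Carlo simulation. $u(N)\sim w(N)$ means $u(N)/w(N)\to1$ as $N\to\infty$.
   Formalization: Proved for integer n and real M>0 (with integer M the limit fails along N = R(R+1)/2 times a prime), with n restricted to n ≥ n0 and the estimator's bias assumed nonzero for all those n (n0=1: no restriction); if the bias vanished at some fixed n, the limit in (a) would be 0. *)

theory Defs
  imports "HOL-Probability.Probability" "HOL-Library.Landau_Symbols"
begin

section \<open>Brownian motion on \<open>[0,T]\<close> relative to a filtration\<close>

definition filtered_on :: "real \<Rightarrow> 'w measure \<Rightarrow> (real \<Rightarrow> 'w measure) \<Rightarrow> bool" where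
  "filtered_on T P F \<longleftrightarrow>
     (\<forall>t\<in>{0..T}. subalgebra P (F t)) \<and>
     (\<forall>s t. 0 \<le> s \<and> s \<le> t \<and> t \<le> T \<longrightarrow> subalgebra (F t) (F s))"

definition brownian_motion ::
  "real \<Rightarrow> 'w measure \<Rightarrow> (real \<Rightarrow> 'w measure) \<Rightarrow> (real \<Rightarrow> 'w \<Rightarrow> real ^ 'q) \<Rightarrow> bool" where
  "brownian_motion T P F W \<longleftrightarrow>
     filtered_on T P F \<and>
     (\<forall>t\<in>{0..T}. W t \<in> borel_measurable (F t)) \<and>
     (AE \<omega> in P. W 0 \<omega> = 0) \<and>
     (AE \<omega> in P. continuous_on {0..T} (\<lambda>t. W t \<omega>)) \<and>
     (\<forall>s t. 0 \<le> s \<and> s < t \<and> t \<le> T \<longrightarrow>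
        prob_space.indep_set P (sets (F s))
          (sets (vimage_algebra (space P) (\<lambda>\<omega>. W t \<omega> - W s \<omega>) borel)) \<and>
        prob_space.indep_vars P (\<lambda>_. borel) (\<lambda>i \<omega>. (W t \<omega> - W s \<omega>) $ i) UNIV \<and>
        (\<forall>i. distributed P lborel (\<lambda>\<omega>. (W t \<omega> - W s \<omega>) $ i)
               (\<lambda>y. ennreal (normal_density 0 (sqrt (t - s)) y))))"

section \<open>Ito integral\<close>

definition tendsto_in_prob ::
  "'w measure \<Rightarrow> (nat \<Rightarrow> 'w \<Rightarrow> 'a::{real_normed_vector, second_countable_topology}) \<Rightarrow> ('w \<Rightarrow> 'a) \<Rightarrow> bool" where
  "tendsto_in_prob P Z L \<longleftrightarrow>
     (\<forall>m. Z m \<in> borel_measurable P) \<and> L \<in> borel_measurable P \<and>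
     (\<forall>e>0. (\<lambda>m. measure P {\<omega> \<in> space P. e < norm (Z m \<omega> - L \<omega>)}) \<longlonglongrightarrow> 0)"

text \<open>A simple integrand equals \<open>\<xi> i\<close> on \<open>(\<tau> i, \<tau> (i + 1)]\<close> for \<open>i < k\<close>.\<close>

definition simple_integrand ::
  "real \<Rightarrow> 'w measure \<Rightarrow> (real \<Rightarrow> 'w measure) \<Rightarrow> nat \<Rightarrow> (nat \<Rightarrow> real) \<Rightarrow>
   (nat \<Rightarrow> 'w \<Rightarrow> real ^ 'q ^ 'd) \<Rightarrow> bool" where
  "simple_integrand T P F k \<tau> \<xi> \<longleftrightarrow>
     \<tau> 0 = 0 \<and> \<tau> k = T \<and> (\<forall>i<k. \<tau> i < \<tau> (Suc i)) \<and>
     (\<forall>i<k. \<xi> i \<in> borel_measurable (F (\<tau> i)) \<and> (\<exists>C. \<forall>\<omega>\<in>space P. norm (\<xi> i \<omega>) \<le> C))"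

definition simple_process ::
  "nat \<Rightarrow> (nat \<Rightarrow> real) \<Rightarrow> (nat \<Rightarrow> 'w \<Rightarrow> real ^ 'q ^ 'd) \<Rightarrow> real \<Rightarrow> 'w \<Rightarrow> real ^ 'q ^ 'd" where
  "simple_process k \<tau> \<xi> s \<omega> = (\<Sum>i<k. indicat_real {\<tau> i<..\<tau> (Suc i)} s *\<^sub>R \<xi> i \<omega>)"

definition simple_ito_integral ::
  "(real \<Rightarrow> 'w \<Rightarrow> real ^ 'q) \<Rightarrow> nat \<Rightarrow> (nat \<Rightarrow> real) \<Rightarrow> (nat \<Rightarrow> 'w \<Rightarrow> real ^ 'q ^ 'd) \<Rightarrow>
   real \<Rightarrow> 'w \<Rightarrow> real ^ 'd" where
  "simple_ito_integral W k \<tau> \<xi> t \<omega> =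
     (\<Sum>i<k. \<xi> i \<omega> *v (W (min t (\<tau> (Suc i))) \<omega> - W (min t (\<tau> i)) \<omega>))"

text \<open>
  \<open>I t = \<integral>\<^sub>0\<^sup>t H\<^sub>s dW\<^sub>s\<close> for \<open>t \<in> [0,T]\<close>: simple integrands approximate \<open>H\<close>, in the sense that the
  square of their distance to \<open>H\<close> in \<open>L\<^sup>2([0,T])\<close> tends to 0 in probability, and their integrals
  converge in probability to the continuous process \<open>I\<close>.  This determines \<open>I\<close> up to
  indistinguishability.
\<close>

definition has_ito_integral ::
  "real \<Rightarrow> 'w measure \<Rightarrow> (real \<Rightarrow> 'w measure) \<Rightarrow> (real \<Rightarrow> 'w \<Rightarrow> real ^ 'q) \<Rightarrow>
   (real \<Rightarrow> 'w \<Rightarrow> real ^ 'q ^ 'd) \<Rightarrow> (real \<Rightarrow> 'w \<Rightarrow> real ^ 'd) \<Rightarrow> bool" where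
  "has_ito_integral T P F W H I \<longleftrightarrow>
     (\<lambda>(s, \<omega>). H s \<omega>) \<in> borel_measurable (restrict_space borel {0..T} \<Otimes>\<^sub>M P) \<and>
     (AE \<omega> in P. continuous_on {0..T} (\<lambda>t. I t \<omega>)) \<and>
     (\<exists>k \<tau> \<xi>.
        (\<forall>m. simple_integrand T P F (k m) (\<tau> m) (\<xi> m)) \<and>
        (\<forall>e>0. (\<lambda>m. measure P {\<omega> \<in> space P.
             ennreal e < (\<integral>\<^sup>+ s\<in>{0..T}.
               ennreal ((norm (simple_process (k m) (\<tau> m) (\<xi> m) s \<omega> - H s \<omega>))\<^sup>2) \<partial>lborel)})
           \<longlonglongrightarrow> 0) \<and>
        (\<forall>t\<in>{0..T}. tendsto_in_prob P
             (\<lambda>m. simple_ito_integral W (k m) (\<tau> m) (\<xi> m) t) (I t)))"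

section \<open>The stochastic differential equation and its Euler schemes\<close>

definition sde_solution ::
  "real \<Rightarrow> 'w measure \<Rightarrow> (real \<Rightarrow> 'w measure) \<Rightarrow> (real \<Rightarrow> 'w \<Rightarrow> real ^ 'q) \<Rightarrow>
   (real \<Rightarrow> real ^ 'd \<Rightarrow> real ^ 'd) \<Rightarrow> (real \<Rightarrow> real ^ 'd \<Rightarrow> real ^ 'q ^ 'd) \<Rightarrow> real ^ 'd \<Rightarrow>
   (real \<Rightarrow> 'w \<Rightarrow> real ^ 'd) \<Rightarrow> bool" where
  "sde_solution T P F W b \<sigma> x X \<longleftrightarrow>
     (\<forall>t\<in>{0..T}. X t \<in> borel_measurable (F t)) \<and>
     (AE \<omega> in P. continuous_on {0..T} (\<lambda>t. X t \<omega>)) \<and>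
     (AE \<omega> in P. set_integrable lborel {0..T} (\<lambda>s. b s (X s \<omega>))) \<and>
     (\<exists>I. has_ito_integral T P F W (\<lambda>s \<omega>. \<sigma> s (X s \<omega>)) I \<and>
          (AE \<omega> in P. \<forall>t\<in>{0..T}. X t \<omega> = x + (LINT s:{0..t}|lborel. b s (X s \<omega>)) + I t \<omega>))"

text \<open>\<open>euler T W b \<sigma> x k j\<close> is the Euler scheme with step \<open>T/k\<close> at time \<open>j T/k\<close>.\<close>

primrec euler ::
  "real \<Rightarrow> (real \<Rightarrow> 'w \<Rightarrow> real ^ 'q) \<Rightarrow> (real \<Rightarrow> real ^ 'd \<Rightarrow> real ^ 'd) \<Rightarrow>
   (real \<Rightarrow> real ^ 'd \<Rightarrow> real ^ 'q ^ 'd) \<Rightarrow> real ^ 'd \<Rightarrow> nat \<Rightarrow> nat \<Rightarrow> 'w \<Rightarrow> real ^ 'd" where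
  "euler T W b \<sigma> x k 0 = (\<lambda>\<omega>. x)"
| "euler T W b \<sigma> x k (Suc j) = (\<lambda>\<omega>.
     let y = euler T W b \<sigma> x k j \<omega>; s = real j * T / real k; t = real (Suc j) * T / real k
     in y + (T / real k) *\<^sub>R b s y + \<sigma> s y *v (W t \<omega> - W s \<omega>))"

definition euler_terminal ::
  "real \<Rightarrow> (real \<Rightarrow> 'w \<Rightarrow> real ^ 'q) \<Rightarrow> (real \<Rightarrow> real ^ 'd \<Rightarrow> real ^ 'd) \<Rightarrow>
   (real \<Rightarrow> real ^ 'd \<Rightarrow> real ^ 'q ^ 'd) \<Rightarrow> real ^ 'd \<Rightarrow> nat \<Rightarrow> 'w \<Rightarrow> real ^ 'd" where
  "euler_terminal T W b \<sigma> x k = euler T W b \<sigma> x k k"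

section \<open>Multi-step Richardson--Romberg extrapolation\<close>

definition rr_weight :: "nat \<Rightarrow> nat \<Rightarrow> real" where
  "rr_weight R r = (-1) ^ (R - r) * real r ^ R / (fact r * fact (R - r))"

definition rr_payoff ::
  "real \<Rightarrow> (real \<Rightarrow> 'w \<Rightarrow> real ^ 'q) \<Rightarrow> (real \<Rightarrow> real ^ 'd \<Rightarrow> real ^ 'd) \<Rightarrow>
   (real \<Rightarrow> real ^ 'd \<Rightarrow> real ^ 'q ^ 'd) \<Rightarrow> real ^ 'd \<Rightarrow> (real ^ 'd \<Rightarrow> real) \<Rightarrow>
   nat \<Rightarrow> nat \<Rightarrow> 'w \<Rightarrow> real" where
  "rr_payoff T W b \<sigma> x f R n \<omega> =
     (\<Sum>r=1..R. rr_weight R r * f (euler_terminal T W b \<sigma> x (r * n) \<omega>))"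

definition rr_const :: "(nat \<Rightarrow> real) \<Rightarrow> nat \<Rightarrow> real" where
  "rr_const c R = c R * (\<Sum>r=1..R. rr_weight R r / real r ^ R)"

text \<open>The copies are the coordinates of the \<open>M\<close>-fold product of \<open>P\<close>; \<open>a\<close> is the target value.\<close>

definition mc_sq_error :: "'w measure \<Rightarrow> real \<Rightarrow> ('w \<Rightarrow> real) \<Rightarrow> nat \<Rightarrow> real" where
  "mc_sq_error P a Z M =
     (\<integral>\<omega>. (a - (1 / real M) * (\<Sum>m<M. Z (\<omega> m)))\<^sup>2 \<partial>(Pi\<^sub>M {..<M} (\<lambda>_. P)))"

section \<open>The minimization problem\<close>

definition rr_error ::
  "nat \<Rightarrow> real \<Rightarrow> real \<Rightarrow> (nat \<Rightarrow> real) \<Rightarrow> (nat \<Rightarrow> real) \<Rightarrow> nat \<times> real \<Rightarrow> real" where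
  "rr_error R V C \<epsilon> \<delta> = (\<lambda>(n, M).
     sqrt (V / M * (1 + \<epsilon> n) + C\<^sup>2 / real n ^ (2 * R) * (1 + \<delta> n)))"

text \<open>
  The discretization parameter \<open>n\<close> is an integer, but \<open>M\<close> is a positive real: with \<open>n\<close> and \<open>M\<close>
  both integers, the equation has only the solutions with \<open>n = 1\<close> or \<open>M = 1\<close> when \<open>N\<close> is
  \<open>R (R + 1) / 2\<close> times a prime, and neither error tends to 0 along these \<open>N\<close>
  (if the bias at \<open>n = 1\<close> is nonzero).

  The bound \<open>n0\<close> (\<open>n0 = 1\<close> for the unrestricted problem) serves to exclude those \<open>n\<close> for which
  the bias of the estimator happens to vanish: the bias is nonzero for large \<open>n\<close>, but if it
  vanished at a fixed \<open>n\<close>, that \<open>n\<close> would give an error of order at most \<open>N powr (-1/2)\<close>,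
  smaller than that of the theorem.
\<close>

definition rr_feasible :: "nat \<Rightarrow> nat \<Rightarrow> real \<Rightarrow> (nat \<times> real) set" where
  "rr_feasible R n0 N =
     {(n, M). n0 \<le> n \<and> 0 < M \<and> real (R * (R + 1)) / 2 * real n * M = N}"

definition rr_min_error ::
  "nat \<Rightarrow> nat \<Rightarrow> real \<Rightarrow> real \<Rightarrow> (nat \<Rightarrow> real) \<Rightarrow> (nat \<Rightarrow> real) \<Rightarrow> real \<Rightarrow> real" where
  "rr_min_error R n0 V C \<epsilon> \<delta> N = (INF p\<in>rr_feasible R n0 N. rr_error R V C \<epsilon> \<delta> p)"

definition rr_Theta :: "nat \<Rightarrow> real" where
  "rr_Theta R =
     2 powr (1 / (2 * (2 * real R + 1))) * real R powr (- 1 / (2 * real R + 1)) *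
     (1 + 1 / real R) powr (real R / (2 * real R + 1)) *
     ((2 * real R) powr (- 2 * real R / (2 * real R + 1)) +
      (2 * real R) powr (1 / (2 * real R + 1))) powr (1 / 2)"

end

theory Submission
  imports Defs "HOL-Real_Asymp.Real_Asymp"
begin

text \<open>
Write \<open>Z n\<close> for the extrapolated payoff. By independence of the copies, the squared error of the estimator
is \<open>Var (Z n) / M + (bias of Z n)\<^sup>2\<close> (\<open>mc_sq_error_decomposition\<close>). Comparing coefficients in \<open>1 / M\<close>
identifies \<open>V * (1 + \<epsilon> n)\<close> with \<open>Var (Z n)\<close> and \<open>C\<^sup>2 / n ^ (2 * R) * (1 + \<delta> n)\<close> with the squared bias, so
\<open>\<epsilon>\<close> tends to 0 by convergence of the variances. The weights annihilate the error terms of order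
\<open>1, ..., R - 1\<close> (\<open>rr_weight_moment\<close>), so the bias is \<open>C / n ^ R + O(1 / n ^ (R + 1))\<close>
(\<open>rr_bias_expansion\<close>), and \<open>\<delta> = O(1 / n)\<close>.

With \<open>\<kappa> = R * (R + 1) / 2\<close> the constraint gives \<open>M = N / (\<kappa> * n)\<close>, and what remains is to minimize over integers \<open>n\<close> a
small perturbation of \<open>\<kappa> * V * n / N + C\<^sup>2 / n ^ (2 * R)\<close>. Put \<open>n = s * N powr (1 / (2 * R + 1))\<close>: the
cost becomes \<open>N powr (- 2 * R / (2 * R + 1))\<close> times a perturbation of \<open>\<phi> s = \<kappa> * V * s + C\<^sup>2 / s ^ (2 * R)\<close>, a
function with a unique, well-separated minimum at \<open>s\<^sub>0\<close>. Since the bias never vanishes for \<open>n \<ge> n0\<close>,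
minimizers tend to infinity, where the perturbation is negligible. Hence their scaled cost tends to
\<open>\<phi> s\<^sub>0\<close> and their rescaled position to \<open>s\<^sub>0\<close> (\<open>minimizer_asymptotics\<close>). The remaining work is to
identify the constants; in particular, \<open>s\<^sub>0 ^ (2 * R + 1) = 2 * R * C\<^sup>2 / (\<kappa> * V)\<close> is exactly what relates
the optimal \<open>M\<close> to \<open>n ^ (2 * R)\<close>.
\<close>

section \<open>Cancellation of the lower-order bias\<close>

text \<open>
Up to sign this is the \<open>n\<close>-th finite difference at 0 of a monomial of degree at most \<open>n\<close>. Absorbing
one factor \<open>r\<close> into the binomial coefficient and expanding the power of the shifted index lowers \<open>n\<close> by
one, which gives the induction.
\<close>

lemma alternating_binomial_power_sum:
  "(\<Sum>r\<le>n. (- 1) ^ r * real (n choose r) * real r ^ j) = (if j = n then (- 1) ^ n * fact n else 0)"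
  if "j \<le> n"
  using that
proof (induction n arbitrary: j)
  case 0
  then show ?case by simp
next
  case (Suc n)
  show ?case
  proof (cases j)
    case 0
    have "(\<Sum>r\<le>Suc n. (- 1) ^ r * real (Suc n choose r)) = 0"
      by (rule choose_alternating_sum) simp
    with 0 show ?thesis by simp
  next
    case (Suc i)
    have absorb: "real (Suc s) * real (Suc n choose Suc s) = real (Suc n) * real (n choose s)" for s
      by (metis Suc_times_binomial of_nat_mult)
    have "(\<Sum>r\<le>Suc n. (- 1) ^ r * real (Suc n choose r) * real r ^ j)
        = (\<Sum>s\<le>n. (- 1) ^ Suc s * real (Suc n choose Suc s) * real (Suc s) ^ Suc i)"
      by (subst sum.atMost_Suc_shift) (simp add: Suc)
    also have "\<dots> = (\<Sum>s\<le>n. (- 1) ^ Suc s * (real (Suc s) * real (Suc n choose Suc s)) * real (Suc s) ^ i)"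
      by (intro sum.cong refl) simp
    also have "\<dots> = (\<Sum>s\<le>n. \<Sum>l\<le>i. - real (Suc n) * (real (i choose l)
          * ((- 1) ^ s * real (n choose s) * real s ^ l)))"
    proof (intro sum.cong refl)
      fix s
      have "real (Suc s) ^ i = (\<Sum>l\<le>i. real (i choose l) * real s ^ l)"
        using binomial_ring[of "real s" 1 i] by (simp add: add.commute)
      then show "(- 1) ^ Suc s * (real (Suc s) * real (Suc n choose Suc s)) * real (Suc s) ^ i
          = (\<Sum>l\<le>i. - real (Suc n) * (real (i choose l)
          * ((- 1) ^ s * real (n choose s) * real s ^ l)))"
        unfolding absorb by (simp add: sum_distrib_left sum_negf mult_ac del: of_nat_Suc)
    qed
    also have "\<dots> = - real (Suc n) * (\<Sum>l\<le>i. real (i choose l)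
          * (\<Sum>s\<le>n. (- 1) ^ s * real (n choose s) * real s ^ l))"
      by (subst sum.swap) (simp add: sum_distrib_left)
    also have "(\<Sum>l\<le>i. real (i choose l) * (\<Sum>s\<le>n. (- 1) ^ s * real (n choose s) * real s ^ l))
        = (\<Sum>l\<le>i. if l = n then real (i choose n) * ((- 1) ^ n * fact n) else 0)"
    proof (intro sum.cong refl)
      fix l assume "l \<in> {..i}"
      then have "l \<le> n" using Suc.prems Suc by simp
      from Suc.IH[OF this] show "real (i choose l) * (\<Sum>s\<le>n. (- 1) ^ s * real (n choose s) * real s ^ l)
        = (if l = n then real (i choose n) * ((- 1) ^ n * fact n) else 0)"
        by simp
    qed
    also have "\<dots> = (if i = n then (- 1) ^ n * fact n else 0)"
      using Suc.prems Suc by (auto simp: sum.delta)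
    finally show ?thesis using Suc by (auto simp del: sum.atMost_Suc of_nat_Suc simp: fact_Suc)
  qed
qed

text \<open>
The weights are the finite-difference coefficients times \<open>r ^ R\<close>, divided by \<open>R!\<close>. Their moments of order
\<open>0 < k < R\<close> are finite differences of \<open>r ^ (R - k)\<close> and vanish: this is the cancellation of the
error terms of order less than \<open>R\<close>.
\<close>

lemma rr_weight_moment:
  assumes "k < R"
  shows "(\<Sum>r=1..R. rr_weight R r / real r ^ k) = (if k = 0 then 1 else 0)"
proof -
  have weight: "rr_weight R r / real r ^ k
      = (- 1) ^ R / fact R * ((- 1) ^ r * real (R choose r) * real r ^ (R - k))"
    if r: "r \<in> {1..R}" for r
  proof -
    have "(- 1) ^ (R - r) = (- 1) ^ R * (- 1 :: real) ^ r"
      using r by (auto simp: minus_one_power_iff)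
    moreover have "real r ^ R / real r ^ k = real r ^ (R - k)"
      using r assms by (simp add: power_diff)
    moreover have "1 / (fact r * fact (R - r)) = real (R choose r) / fact R"
      using r by (simp add: binomial_fact)
    moreover have "rr_weight R r / real r ^ k
        = (- 1) ^ (R - r) * (1 / (fact r * fact (R - r))) * (real r ^ R / real r ^ k)"
      unfolding rr_weight_def by simp
    ultimately show ?thesis
      by simp
  qed
  have "(\<Sum>r=1..R. rr_weight R r / real r ^ k)
      = (- 1) ^ R / fact R * (\<Sum>r=1..R. (- 1) ^ r * real (R choose r) * real r ^ (R - k))"
    unfolding sum_distrib_left by (intro sum.cong refl weight)
  also have "(\<Sum>r=1..R. (- 1) ^ r * real (R choose r) * real r ^ (R - k))
      = (\<Sum>r\<le>R. (- 1) ^ r * real (R choose r) * real r ^ (R - k))"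
    \<comment> \<open>the added term at 0 vanishes because its exponent \<open>R - k\<close> is positive\<close>
    using assms by (intro sum.mono_neutral_left) (auto simp: not_le)
  also have "\<dots> = (if k = 0 then (- 1) ^ R * fact R else 0)"
    using assms by (subst alternating_binomial_power_sum) auto
  finally show ?thesis by (simp flip: power_add add: mult_2[symmetric])
qed

text \<open>
Substituting the expansion at \<open>r * n\<close> and interchanging the two finite sums leaves the moments of the
weights, of which only the one of order \<open>R\<close> survives.
\<close>

lemma rr_bias_expansion:
  fixes e :: "nat \<Rightarrow> real"
  assumes "1 \<le> R"
    and expansion: "(\<lambda>n. e n - (\<Sum>k=1..R. c k / real n ^ k)) \<in> O(\<lambda>n. 1 / real n ^ (R + 1))"
  shows "(\<lambda>n. (\<Sum>r=1..R. rr_weight R r * e (r * n)) - rr_const c R / real n ^ R)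
           \<in> O(\<lambda>n. 1 / real n ^ (R + 1))"
proof -
  define g where "g n = e n - (\<Sum>k=1..R. c k / real n ^ k)" for n
  have "(\<Sum>r=1..R. rr_weight R r * (\<Sum>k=1..R. c k / real (r * n) ^ k)) = rr_const c R / real n ^ R" for n
  proof -
    have "(\<Sum>r=1..R. rr_weight R r * (\<Sum>k=1..R. c k / real (r * n) ^ k))
        = (\<Sum>k=1..R. c k / real n ^ k * (\<Sum>r=1..R. rr_weight R r / real r ^ k))"
      unfolding sum_distrib_left
      by (subst sum.swap) (simp add: power_mult_distrib mult_ac)
    also have "\<dots> = (\<Sum>k=1..R. if k = R then rr_const c R / real n ^ R else 0)"
      by (intro sum.cong refl) (auto simp: rr_const_def rr_weight_moment simp flip: One_nat_def)
    also have "\<dots> = rr_const c R / real n ^ R"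
      using assms(1) by simp
    finally show ?thesis .
  qed
  then have eq: "(\<Sum>r=1..R. rr_weight R r * e (r * n)) - rr_const c R / real n ^ R
      = (\<Sum>r=1..R. rr_weight R r * g (r * n))" for n
    unfolding g_def by (simp add: right_diff_distrib sum_subtractf)
  have "(\<lambda>n. rr_weight R r * g (r * n)) \<in> O(\<lambda>n. 1 / real n ^ (R + 1))" if "r \<in> {1..R}" for r
  proof -
    have lim: "filterlim (\<lambda>n. r * n) at_top sequentially"
      using that by (intro filterlim_subseq) (auto simp: strict_mono_def)
    have "(\<lambda>n. g (r * n)) \<in> O(\<lambda>n. 1 / real (r * n) ^ (R + 1))"
      using landau_o.big.compose[OF expansion lim] unfolding g_def .
    also have "(\<lambda>n. 1 / real (r * n) ^ (R + 1)) = (\<lambda>n. 1 / real r ^ (R + 1) * (1 / real n ^ (R + 1)))"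
      by (simp add: power_mult_distrib mult_ac)
    also have "\<dots> \<in> O(\<lambda>n. 1 / real n ^ (R + 1))"
      by (rule bigoI[of _ "1 / real r ^ (R + 1)"]) simp
    finally show ?thesis by simp
  qed
  then show ?thesis unfolding eq by (intro big_sum_in_bigo)
qed

text \<open>
If \<open>\<eta>\<close> is the relative error of \<open>\<beta>\<close> with respect to its leading term, then \<open>1 + \<delta>\<close> is the square of
\<open>1 + \<eta>\<close>, so that \<open>\<delta> = 2 * \<eta> + \<eta>\<^sup>2\<close>.
\<close>

lemma relative_sq_bias_bigo:
  fixes \<beta> \<delta> :: "nat \<Rightarrow> real"
  assumes "C \<noteq> 0" and bias: "(\<lambda>n. \<beta> n - C / real n ^ R) \<in> O(\<lambda>n. 1 / real n ^ (R + 1))"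
    and sq: "\<And>n. 1 \<le> n \<Longrightarrow> (\<beta> n)\<^sup>2 = C\<^sup>2 / real n ^ (2 * R) * (1 + \<delta> n)"
  shows "\<delta> \<in> O(\<lambda>n. 1 / real n)"
proof -
  define \<eta> where "\<eta> n = real n ^ R / C * (\<beta> n - C / real n ^ R)" for n
  have "\<eta> \<in> O(\<lambda>n. real n ^ R / C * (1 / real n ^ (R + 1)))"
    unfolding \<eta>_def by (intro landau_o.big.mult bias) simp
  also have "(\<lambda>n. real n ^ R / C * (1 / real n ^ (R + 1))) \<in> O(\<lambda>n. 1 / real n)"
    using \<open>C \<noteq> 0\<close> by (intro bigoI[of _ "1 / \<bar>C\<bar>"] always_eventually allI) (simp add: abs_mult)
  finally have \<eta>: "\<eta> \<in> O(\<lambda>n. 1 / real n)" .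
  have "(\<lambda>n. \<eta> n * \<eta> n) \<in> O(\<lambda>n. 1 / real n * (1 / real n))"
    by (intro landau_o.big.mult \<eta>)
  also have "(\<lambda>n. 1 / real n * (1 / real n)) \<in> O(\<lambda>n. 1 / real n)"
  proof (intro bigoI[of _ 1] always_eventually allI)
    show "norm (1 / real n * (1 / real n)) \<le> 1 * norm (1 / real n)" for n
      using mult_left_le[of "1 / real n" "1 / real n"] by (cases "n = 0") auto
  qed
  finally have "(\<lambda>n. 2 * \<eta> n + \<eta> n * \<eta> n) \<in> O(\<lambda>n. 1 / real n)"
    using \<eta> by (intro sum_in_bigo) simp_all
  moreover have "eventually (\<lambda>n. 2 * \<eta> n + \<eta> n * \<eta> n = \<delta> n) sequentially"
    using eventually_ge_at_top[of 1]
  proof eventually_elim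
    case (elim n)
    then have "\<beta> n = C / real n ^ R * (1 + \<eta> n)"
      using \<open>C \<noteq> 0\<close> by (simp add: \<eta>_def field_simps)
    with sq[OF elim] elim \<open>C \<noteq> 0\<close> have "(1 + \<eta> n)\<^sup>2 = 1 + \<delta> n"
      by (simp add: power_mult_distrib power_divide power_mult[symmetric] mult.commute)
    then show ?case by (simp add: power2_eq_square algebra_simps)
  qed
  ultimately show ?thesis by (simp cong: landau_o.big.in_cong)
qed

section \<open>Mean squared error of independent copies\<close>

text \<open>
Expanding the square of the mean of the centred copies \<open>a - Z\<close> gives a double sum. By Fubini, its
diagonal terms contribute the second moment and its off-diagonal terms the squared mean of \<open>a - Z\<close>.
\<close>

lemma mc_sq_error_decomposition:
  fixes Z :: "'w \<Rightarrow> real"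
  assumes P: "prob_space P" and Z[measurable]: "Z \<in> borel_measurable P"
    and sq: "integrable P (\<lambda>\<omega>. (Z \<omega>)\<^sup>2)" and M: "1 \<le> M"
  shows "mc_sq_error P a Z M
       = prob_space.variance P Z / real M + (a - prob_space.expectation P Z)\<^sup>2"
proof -
  interpret prob_space P by fact
  interpret prod: product_sigma_finite "\<lambda>_::nat. P" ..
  have int_Z: "integrable P Z" using square_integrable_imp_integrable[OF Z sq] .
  define Y where "Y \<omega> = a - Z \<omega>" for \<omega>
  define q where "q = expectation (\<lambda>\<omega>. (Y \<omega>)\<^sup>2)"
  have int_Y: "integrable P Y" unfolding Y_def using int_Z by simp
  have int_Y2: "integrable P (\<lambda>\<omega>. Y \<omega> * Y \<omega>)"
    unfolding Y_def using int_Z sq by (simp add: algebra_simps power2_eq_square)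
  have EY: "expectation Y = a - expectation Z"
    unfolding Y_def using int_Z by (simp add: prob_space)
  have var: "variance Z = q - (expectation Y)\<^sup>2"
  proof -
    have "q = a\<^sup>2 - 2 * a * expectation Z + expectation (\<lambda>\<omega>. (Z \<omega>)\<^sup>2)"
      unfolding q_def Y_def power2_diff using int_Z sq by (simp add: prob_space)
    then show ?thesis unfolding EY variance_eq[OF int_Z sq] by (simp add: power2_eq_square algebra_simps)
  qed
  let ?Pi = "Pi\<^sub>M {..<M} (\<lambda>_. P)"
  have pair: "integrable ?Pi (\<lambda>\<omega>. Y (\<omega> i) * Y (\<omega> j)) \<and>
      (\<integral>\<omega>. Y (\<omega> i) * Y (\<omega> j) \<partial>?Pi) = (if i = j then q else (expectation Y)\<^sup>2)"
    if ij: "i < M" "j < M" for i j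
  proof -
    \<comment> \<open>the product over the coordinates of the factors \<open>h\<close> is \<open>Y (\<omega> i) * Y (\<omega> j)\<close>, also when \<open>i = j\<close>\<close>
    define h where "h m z = (if m = i then Y z else 1) * (if m = j then Y z else 1)" for m z
    have prod_h: "(\<Prod>m<M. h m (\<omega> m)) = Y (\<omega> i) * Y (\<omega> j)" for \<omega>
      using ij unfolding h_def prod.distrib by (simp add: prod.delta)
    have int_h: "integrable P (h m)" for m
      unfolding h_def using int_Y int_Y2 by (cases "m = i"; cases "m = j") auto
    have "(\<Prod>m<M. expectation (h m)) = (if i = j then q else (expectation Y)\<^sup>2)"
    proof (cases "i = j")
      case True
      then have "expectation (h m) = (if m = i then q else 1)" for m
        unfolding h_def q_def by (simp add: prob_space power2_eq_square)
      with ij True show ?thesis by simp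
    next
      case False
      then have "expectation (h m) = (if m = i then expectation Y else 1) * (if m = j then expectation Y else 1)" for m
        unfolding h_def by (simp add: prob_space)
      with ij False show ?thesis by (simp add: prod.distrib power2_eq_square)
    qed
    then show ?thesis
      using prod.product_integral_prod[of "{..<M}" h] prod.product_integrable_prod[of "{..<M}" h] int_h
      by (simp add: prod_h)
  qed
  have expand: "(a - (1 / real M) * (\<Sum>m<M. Z (\<omega> m)))\<^sup>2
      = 1 / (real M)\<^sup>2 * (\<Sum>i<M. \<Sum>j<M. Y (\<omega> i) * Y (\<omega> j))" for \<omega>
  proof -
    have "a - (1 / real M) * (\<Sum>m<M. Z (\<omega> m)) = 1 / real M * (\<Sum>m<M. Y (\<omega> m))"
      using M unfolding Y_def by (simp add: sum_subtractf field_simps)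
    then show ?thesis
      by (simp add: power_mult_distrib power_divide power2_eq_square sum_product)
  qed
  have "mc_sq_error P a Z M = 1 / (real M)\<^sup>2 * (\<Sum>i<M. \<Sum>j<M. if i = j then q else (expectation Y)\<^sup>2)"
  proof -
    have "(\<integral>\<omega>. (\<Sum>i<M. \<Sum>j<M. Y (\<omega> i) * Y (\<omega> j)) \<partial>?Pi)
        = (\<Sum>i<M. \<Sum>j<M. \<integral>\<omega>. Y (\<omega> i) * Y (\<omega> j) \<partial>?Pi)"
      using pair by (subst Bochner_Integration.integral_sum; (intro Bochner_Integration.integrable_sum sum.cong refl)?)
        (auto intro!: Bochner_Integration.integral_sum)
    also have "\<dots> = (\<Sum>i<M. \<Sum>j<M. if i = j then q else (expectation Y)\<^sup>2)"
      using pair by (intro sum.cong refl) auto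
    finally show ?thesis
      unfolding mc_sq_error_def expand by simp
  qed
  also have "(\<Sum>i<M. \<Sum>j<M. if i = j then q else (expectation Y)\<^sup>2)
      = (\<Sum>i<M. (q - (expectation Y)\<^sup>2) + real M * (expectation Y)\<^sup>2)"
  proof (intro sum.cong refl)
    fix i assume "i \<in> {..<M}"
    moreover have "(\<Sum>j<M. if i = j then q else (expectation Y)\<^sup>2)
        = (\<Sum>j<M. (if i = j then q - (expectation Y)\<^sup>2 else 0) + (expectation Y)\<^sup>2)"
      by (intro sum.cong) auto
    ultimately show "(\<Sum>j<M. if i = j then q else (expectation Y)\<^sup>2)
        = (q - (expectation Y)\<^sup>2) + real M * (expectation Y)\<^sup>2"
      by (simp add: sum.distrib)
  qed
  also have "1 / (real M)\<^sup>2 * \<dots> = variance Z / real M + (a - expectation Z)\<^sup>2"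
    using M unfolding var EY by (simp add: field_simps power2_eq_square)
  finally show ?thesis .
qed

lemma continuous_on_matrix_vector_mult:
  "continuous_on UNIV (\<lambda>p :: (real ^ 'q ^ 'd) \<times> (real ^ 'q). fst p *v snd p)"
  unfolding matrix_vector_mult_def
  by (intro continuous_on_vec_lambda continuous_intros)

lemma borel_measurable_euler:
  fixes W :: "real \<Rightarrow> 'w \<Rightarrow> real ^ 'q" and b :: "real \<Rightarrow> real ^ 'd \<Rightarrow> real ^ 'd"
  assumes "0 < T" and W: "\<And>t. t \<in> {0..T} \<Longrightarrow> W t \<in> borel_measurable P"
    and b: "(\<lambda>(t, y). b t y) \<in> borel_measurable borel"
    and \<sigma>: "(\<lambda>(t, y). \<sigma> t y) \<in> borel_measurable borel"
    and "j \<le> k"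
  shows "euler T W b \<sigma> x k j \<in> borel_measurable P"
  using \<open>j \<le> k\<close>
proof (induction j)
  case 0
  then show ?case by simp
next
  case (Suc j)
  let ?y = "euler T W b \<sigma> x k j"
  let ?s = "real j * T / real k" and ?t = "real (Suc j) * T / real k"
  have times: "?s \<in> {0..T}" "?t \<in> {0..T}"
    using Suc.prems \<open>0 < T\<close> by (auto simp: field_simps simp del: of_nat_Suc)
  have y: "?y \<in> borel_measurable P" using Suc by simp
  have arg: "(\<lambda>\<omega>. (?s, ?y \<omega>)) \<in> borel_measurable P"
    using y by (intro borel_measurable_Pair) auto
  have drift: "(\<lambda>\<omega>. b ?s (?y \<omega>)) \<in> borel_measurable P"
    using measurable_compose[OF arg b] by simp
  have diffusion: "(\<lambda>\<omega>. \<sigma> ?s (?y \<omega>)) \<in> borel_measurable P"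
    using measurable_compose[OF arg \<sigma>] by simp
  have "(\<lambda>\<omega>. W ?t \<omega> - W ?s \<omega>) \<in> borel_measurable P"
    using W[OF times(1)] W[OF times(2)] by (rule borel_measurable_diff[rotated])
  then have "(\<lambda>\<omega>. \<sigma> ?s (?y \<omega>) *v (W ?t \<omega> - W ?s \<omega>)) \<in> borel_measurable P"
    by (intro borel_measurable_continuous_Pair[OF diffusion _ continuous_on_matrix_vector_mult])
  then have "(\<lambda>\<omega>. ?y \<omega> + (T / real k) *\<^sub>R b ?s (?y \<omega>) + \<sigma> ?s (?y \<omega>) *v (W ?t \<omega> - W ?s \<omega>))
      \<in> borel_measurable P"
    by (intro borel_measurable_add borel_measurable_scaleR y drift borel_measurable_const)
  then show ?case by (simp add: Let_def)
qed

text \<open>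
Follows from \<open>(u + v)\<^sup>2 \<le> 2 * u\<^sup>2 + 2 * v\<^sup>2\<close>, one summand at a time.
\<close>

lemma square_integrable_sum:
  fixes g :: "'i \<Rightarrow> 'w \<Rightarrow> real"
  assumes "finite I" "\<And>i. i \<in> I \<Longrightarrow> g i \<in> borel_measurable P"
    "\<And>i. i \<in> I \<Longrightarrow> integrable P (\<lambda>\<omega>. (g i \<omega>)\<^sup>2)"
  shows "integrable P (\<lambda>\<omega>. (\<Sum>i\<in>I. a i * g i \<omega>)\<^sup>2)"
  using assms
proof (induction I)
  case empty
  then show ?case by simp
next
  case (insert i I)
  let ?S = "\<lambda>\<omega>. \<Sum>i\<in>I. a i * g i \<omega>"
  have "integrable P (\<lambda>\<omega>. 2 * ((a i)\<^sup>2 * (g i \<omega>)\<^sup>2) + 2 * (?S \<omega>)\<^sup>2)"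
    using insert by auto
  moreover have "(\<lambda>\<omega>. (a i * g i \<omega> + ?S \<omega>)\<^sup>2) \<in> borel_measurable P"
    using insert.prems by (intro borel_measurable_power borel_measurable_add borel_measurable_sum
        borel_measurable_times borel_measurable_const) auto
  ultimately have "integrable P (\<lambda>\<omega>. (a i * g i \<omega> + ?S \<omega>)\<^sup>2)"
  proof (rule Bochner_Integration.integrable_bound, intro AE_I2)
    fix \<omega>
    have "(a i * g i \<omega> + ?S \<omega>)\<^sup>2 \<le> 2 * (a i * g i \<omega>)\<^sup>2 + 2 * (?S \<omega>)\<^sup>2"
      using sum_squares_bound[of "a i * g i \<omega>" "?S \<omega>"] by (simp add: power2_sum)
    then show "norm ((a i * g i \<omega> + ?S \<omega>)\<^sup>2) \<le> norm (2 * ((a i)\<^sup>2 * (g i \<omega>)\<^sup>2) + 2 * (?S \<omega>)\<^sup>2)"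
      by (simp add: power_mult_distrib)
  qed
  with insert show ?case by simp
qed

section \<open>Optimal balance of variance and squared bias\<close>

text \<open>
In the scaling \<open>n = s * N powr (1 / (m + 1))\<close>, the statistical part \<open>A * n / N\<close> and the squared bias
\<open>B / n ^ m\<close> of the cost are both proportional to \<open>N powr (- m / (m + 1))\<close>; the function of \<open>s\<close> below
is the coefficient.
\<close>

definition leading_cost :: "real \<Rightarrow> real \<Rightarrow> nat \<Rightarrow> real \<Rightarrow> real" where
  "leading_cost A B m s = A * s + B / s ^ m"

definition opt_scale :: "real \<Rightarrow> real \<Rightarrow> nat \<Rightarrow> real" where
  "opt_scale A B m = (real m * B / A) powr (1 / (real m + 1))"

text \<open>
The positivity of \<open>1 + \<delta> n\<close> for all admissible \<open>n\<close>, not only for large \<open>n\<close>, says that the bias never vanishes.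
It is what forces minimizers to infinity: a fixed \<open>n\<close> without bias would give a cost of order \<open>1 / N\<close>,
less than the order \<open>N powr (- m / (m + 1))\<close> of the optimal balance.
\<close>

locale discretization_tradeoff =
  fixes A B :: real and m n0 :: nat and \<epsilon> \<delta> :: "nat \<Rightarrow> real"
  assumes A_pos: "0 < A" and B_pos: "0 < B" and m_pos: "1 \<le> m" and n0_pos: "1 \<le> n0"
    and eps_lim: "\<epsilon> \<longlonglongrightarrow> 0" and delta_lim: "\<delta> \<longlonglongrightarrow> 0"
    and eps_nonneg: "\<And>n. n0 \<le> n \<Longrightarrow> 0 \<le> 1 + \<epsilon> n"
    and delta_pos: "\<And>n. n0 \<le> n \<Longrightarrow> 0 < 1 + \<delta> n"
begin

definition cost :: "real \<Rightarrow> nat \<Rightarrow> real" where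
  "cost N n = A * real n / N * (1 + \<epsilon> n) + B / real n ^ m * (1 + \<delta> n)"

abbreviation "\<phi> \<equiv> leading_cost A B m"
abbreviation "s\<^sub>0 \<equiv> opt_scale A B m"

definition scale :: "real \<Rightarrow> real" where
  "scale N = N powr (1 / (real m + 1))"

lemma opt_scale_pos: "0 < s\<^sub>0"
  using A_pos B_pos m_pos by (simp add: opt_scale_def)

lemma opt_scale_power: "s\<^sub>0 ^ (m + 1) = real m * B / A"
proof -
  have "s\<^sub>0 ^ (m + 1) = s\<^sub>0 powr (real m + 1)"
    using powr_realpow[OF opt_scale_pos, of "m + 1"] by (simp add: add.commute)
  also have "\<dots> = real m * B / A"
    using A_pos B_pos m_pos by (simp add: opt_scale_def powr_powr)
  finally show ?thesis .
qed

lemma scale_pos: "0 < N \<Longrightarrow> 0 < scale N"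
  by (simp add: scale_def)

lemma scale_power:
  assumes "0 < N" shows "scale N ^ (m + 1) = N"
proof -
  have "scale N ^ (m + 1) = scale N powr (real m + 1)"
    using powr_realpow[OF scale_pos[OF assms], of "m + 1"] by (simp add: add.commute)
  then show ?thesis
    using assms by (simp add: scale_def powr_powr)
qed

lemma scale_at_top: "filterlim scale at_top at_top"
  unfolding scale_def by (rule real_powr_at_top) simp

lemma leading_cost_deriv:
  assumes "0 < s"
  shows "(\<phi> has_real_derivative A * (s ^ (m + 1) - s\<^sub>0 ^ (m + 1)) / s ^ (m + 1)) (at s)"
proof -
  have "(\<phi> has_real_derivative A + - (real m * s ^ (m - 1) * B) / (s ^ m * s ^ m)) (at s)"
    unfolding leading_cost_def [abs_def]
    using assms by (auto intro!: derivative_eq_intros)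
  moreover have "A + - (real m * s ^ (m - 1) * B) / (s ^ m * s ^ m)
      = A * (s ^ (m + 1) - s\<^sub>0 ^ (m + 1)) / s ^ (m + 1)"
    unfolding opt_scale_power using assms A_pos m_pos by (cases m) (auto simp: field_simps)
  ultimately show ?thesis by simp
qed

lemma leading_cost_continuous: "0 < s \<Longrightarrow> continuous_on {s..t} \<phi>"
  unfolding leading_cost_def [abs_def] by (auto intro!: continuous_intros)

lemma leading_cost_increasing:
  assumes "s\<^sub>0 \<le> s" "s < t"
  shows "\<phi> s < \<phi> t"
proof (rule DERIV_pos_imp_increasing_open[OF assms(2)])
  fix u assume u: "s < u" "u < t"
  have "s\<^sub>0 ^ (m + 1) < u ^ (m + 1)"
    using assms u opt_scale_pos by (intro power_strict_mono) auto
  then show "\<exists>y. (\<phi> has_real_derivative y) (at u) \<and> 0 < y"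
    using leading_cost_deriv[of u] assms u opt_scale_pos A_pos
    by (intro exI[of _ "A * (u ^ (m + 1) - s\<^sub>0 ^ (m + 1)) / u ^ (m + 1)"]) auto
qed (use leading_cost_continuous assms opt_scale_pos in auto)

lemma leading_cost_decreasing:
  assumes "0 < s" "s < t" "t \<le> s\<^sub>0"
  shows "\<phi> t < \<phi> s"
proof (rule DERIV_neg_imp_decreasing_open[OF assms(2)])
  fix u assume u: "s < u" "u < t"
  have "u ^ (m + 1) < s\<^sub>0 ^ (m + 1)"
    using assms u by (intro power_strict_mono) auto
  then show "\<exists>y. (\<phi> has_real_derivative y) (at u) \<and> y < 0"
    using leading_cost_deriv[of u] assms u A_pos
    by (intro exI[of _ "A * (u ^ (m + 1) - s\<^sub>0 ^ (m + 1)) / u ^ (m + 1)"])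
       (auto intro!: divide_neg_pos mult_pos_neg)
qed (use leading_cost_continuous assms in auto)

lemma leading_cost_min: "0 < s \<Longrightarrow> \<phi> s\<^sub>0 \<le> \<phi> s"
  using leading_cost_increasing[of s\<^sub>0 s] leading_cost_decreasing[of s s\<^sub>0] opt_scale_pos
  by (cases s s\<^sub>0 rule: linorder_cases) auto

lemma leading_cost_min_value: "\<phi> s\<^sub>0 = A * s\<^sub>0 * (1 + 1 / real m)"
proof -
  have "B / s\<^sub>0 ^ m = A * s\<^sub>0 / real m"
    using opt_scale_power A_pos m_pos opt_scale_pos by (simp add: field_simps)
  then show ?thesis by (simp add: leading_cost_def algebra_simps)
qed

text \<open>
The minimum of \<open>\<phi>\<close> is well separated, because \<open>\<phi>\<close> is strictly monotone on either side of \<open>s\<^sub>0\<close>; so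
convergence of the values to the minimum forces convergence of the arguments.
\<close>

lemma tendsto_opt_scale:
  assumes pos: "eventually (\<lambda>N. 0 < u N) G" and lim: "((\<lambda>N. \<phi> (u N)) \<longlongrightarrow> \<phi> s\<^sub>0) G"
  shows "(u \<longlongrightarrow> s\<^sub>0) G"
proof (rule order_tendstoI)
  fix a assume a: "a < s\<^sub>0"
  \<comment> \<open>the comparison point must be positive, as \<open>\<phi>\<close> decreases only on \<open>(0, s\<^sub>0]\<close>\<close>
  define a' where "a' = max a (s\<^sub>0 / 2)"
  have a': "0 < a'" "a' < s\<^sub>0" "a \<le> a'" using a opt_scale_pos by (auto simp: a'_def)
  have "eventually (\<lambda>N. \<phi> (u N) < \<phi> a') G"
    using leading_cost_decreasing[of a' s\<^sub>0] a' by (intro order_tendstoD(2)[OF lim]) auto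
  with pos show "eventually (\<lambda>N. a < u N) G"
  proof eventually_elim
    case (elim N)
    have "\<not> u N \<le> a'" using leading_cost_decreasing[of "u N" a'] a' elim by (cases "u N = a'") auto
    with a' show ?case by simp
  qed
next
  fix a assume a: "s\<^sub>0 < a"
  have "eventually (\<lambda>N. \<phi> (u N) < \<phi> a) G"
    using leading_cost_increasing[of s\<^sub>0 a] a by (intro order_tendstoD(2)[OF lim]) auto
  then show "eventually (\<lambda>N. u N < a) G"
  proof eventually_elim
    case (elim N)
    then show ?case using leading_cost_increasing[of a "u N"] a
      by (cases "u N" a rule: linorder_cases) auto
  qed
qed

lemma scaled_cost:
  assumes "0 < N" "0 < n"
  shows "scale N ^ m * cost N n
       = A * (real n / scale N) * (1 + \<epsilon> n) + B / (real n / scale N) ^ m * (1 + \<delta> n)"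
proof -
  have "scale N ^ m / N = 1 / scale N"
    using scale_power[OF assms(1)] scale_pos[OF assms(1)] assms by (simp add: field_simps)
  moreover have "scale N ^ m * (A * real n / N * (1 + \<epsilon> n)) = (scale N ^ m / N) * (A * real n * (1 + \<epsilon> n))"
    by simp
  ultimately have "scale N ^ m * (A * real n / N * (1 + \<epsilon> n)) = A * (real n / scale N) * (1 + \<epsilon> n)"
    by simp
  moreover have "scale N ^ m * (B / real n ^ m * (1 + \<delta> n)) = B / (real n / scale N) ^ m * (1 + \<delta> n)"
    by (simp add: power_divide)
  ultimately show ?thesis unfolding cost_def by (simp add: distrib_left)
qed

lemma scaled_cost_tendsto:
  assumes "filterlim k at_top at_top" and ratio: "((\<lambda>N. real (k N) / scale N) \<longlongrightarrow> s) at_top" and "0 < s"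
  shows "((\<lambda>N. scale N ^ m * cost N (k N)) \<longlongrightarrow> \<phi> s) at_top"
proof -
  have "((\<lambda>N. \<epsilon> (k N)) \<longlongrightarrow> 0) at_top" "((\<lambda>N. \<delta> (k N)) \<longlongrightarrow> 0) at_top"
    using eps_lim delta_lim assms(1) by (auto intro: filterlim_compose)
  then have "((\<lambda>N. A * (real (k N) / scale N) * (1 + \<epsilon> (k N))
      + B / (real (k N) / scale N) ^ m * (1 + \<delta> (k N))) \<longlongrightarrow> A * s * (1 + 0) + B / s ^ m * (1 + 0)) at_top"
    using assms by (intro tendsto_intros) auto
  moreover have "eventually (\<lambda>N. A * (real (k N) / scale N) * (1 + \<epsilon> (k N))
      + B / (real (k N) / scale N) ^ m * (1 + \<delta> (k N)) = scale N ^ m * cost N (k N)) at_top"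
    using eventually_gt_at_top[of 0] filterlim_at_top[THEN iffD1, OF assms(1), rule_format, of 1]
    by eventually_elim (simp add: scaled_cost)
  ultimately show ?thesis
    by (simp add: leading_cost_def tendsto_cong)
qed

text \<open>
Rounding the ideal real parameter up to an integer gives a competitor which already attains the
leading order of the minimum.
\<close>

definition candidate :: "real \<Rightarrow> nat" where
  "candidate N = nat \<lceil>s\<^sub>0 * scale N\<rceil>"

lemma candidate_ratio: "((\<lambda>N. real (candidate N) / scale N) \<longlongrightarrow> s\<^sub>0) at_top"
proof (rule tendsto_sandwich[of "\<lambda>_. s\<^sub>0" _ _ "\<lambda>N. s\<^sub>0 + 1 / scale N"])
  have *: "eventually (\<lambda>N. 0 < scale N) at_top"
    using eventually_gt_at_top[of 0] by eventually_elim (rule scale_pos)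
  have ceil: "real (candidate N) = real_of_int \<lceil>s\<^sub>0 * scale N\<rceil>" if "0 < scale N" for N
    using that opt_scale_pos mult_pos_pos[OF opt_scale_pos that] unfolding candidate_def
    by (intro of_nat_nat) linarith
  show "eventually (\<lambda>N. s\<^sub>0 \<le> real (candidate N) / scale N) at_top"
    using * by eventually_elim (simp add: ceil field_simps)
  show "eventually (\<lambda>N. real (candidate N) / scale N \<le> s\<^sub>0 + 1 / scale N) at_top"
    using *
  proof eventually_elim
    case (elim N)
    have "real_of_int \<lceil>s\<^sub>0 * scale N\<rceil> \<le> s\<^sub>0 * scale N + 1" by linarith
    then show ?case using elim by (simp add: ceil field_simps)
  qed
  have "((\<lambda>N. s\<^sub>0 + 1 / scale N) \<longlongrightarrow> s\<^sub>0 + 0) at_top"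
    by (intro tendsto_intros tendsto_divide_0[OF tendsto_const]
        filterlim_at_top_imp_at_infinity scale_at_top)
  then show "((\<lambda>N. s\<^sub>0 + 1 / scale N) \<longlongrightarrow> s\<^sub>0) at_top" by simp
qed simp

lemma filterlim_nat_scale:
  assumes "((\<lambda>N. real (k N) / scale N) \<longlongrightarrow> s) at_top" "0 < s"
  shows "filterlim k at_top at_top"
proof -
  have "filterlim (\<lambda>N. real (k N) / scale N * scale N) at_top at_top"
    by (rule filterlim_tendsto_pos_mult_at_top[OF assms scale_at_top])
  moreover have "eventually (\<lambda>N. real (k N) / scale N * scale N = real (k N)) at_top"
    using eventually_gt_at_top[of 0] by eventually_elim (use scale_pos in force)
  ultimately have "filterlim (\<lambda>N. real (k N)) at_top at_top"
    by (simp add: filterlim_cong)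
  then show ?thesis by (simp add: filterlim_sequentially_iff_filterlim_real)
qed

lemma candidate_at_top: "filterlim candidate at_top at_top"
  using filterlim_nat_scale[OF candidate_ratio opt_scale_pos] .

lemma candidate_cost: "((\<lambda>N. scale N ^ m * cost N (candidate N)) \<longlongrightarrow> \<phi> s\<^sub>0) at_top"
  using scaled_cost_tendsto[OF candidate_at_top candidate_ratio opt_scale_pos] .

lemma candidate_cost_0: "((\<lambda>N. cost N (candidate N)) \<longlongrightarrow> 0) at_top"
proof -
  have "filterlim (\<lambda>N. scale N ^ m) at_top at_top"
    using m_pos by (intro filterlim_pow_at_top scale_at_top) auto
  then have "((\<lambda>N. scale N ^ m * cost N (candidate N) / scale N ^ m) \<longlongrightarrow> 0) at_top"
    by (intro tendsto_divide_0[OF candidate_cost] filterlim_at_top_imp_at_infinity)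
  moreover have "eventually (\<lambda>N. scale N ^ m * cost N (candidate N) / scale N ^ m = cost N (candidate N)) at_top"
    using eventually_gt_at_top[of 0] by eventually_elim (use scale_pos in force)
  ultimately show ?thesis by (simp add: tendsto_cong)
qed

text \<open>
The statistical part of the cost grows linearly in \<open>n\<close>, so only finitely many \<open>n\<close> can compete with \<open>n0\<close>.
\<close>

lemma minimizer_exists:
  assumes "0 < N"
  shows "\<exists>n\<ge>n0. \<forall>k\<ge>n0. cost N n \<le> cost N k"
proof -
  have "filterlim (\<lambda>n. A / N * (1 + \<epsilon> n) * real n) at_top sequentially"
  proof (rule filterlim_tendsto_pos_mult_at_top)
    show "(\<lambda>n. A / N * (1 + \<epsilon> n)) \<longlonglongrightarrow> A / N * (1 + 0)"
      by (intro tendsto_intros eps_lim)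
  qed (use A_pos assms in \<open>auto intro: filterlim_real_sequentially\<close>)
  then have "eventually (\<lambda>n. cost N n0 \<le> A / N * (1 + \<epsilon> n) * real n) sequentially"
    by (simp add: filterlim_at_top)
  then obtain K where K: "\<And>n. K \<le> n \<Longrightarrow> cost N n0 \<le> A / N * (1 + \<epsilon> n) * real n"
    by (auto simp: eventually_sequentially)
  have tail: "cost N n0 \<le> cost N n" if "n0 \<le> n" "K \<le> n" for n
  proof -
    have "0 \<le> B / real n ^ m * (1 + \<delta> n)" using B_pos delta_pos[OF that(1)] by simp
    then show ?thesis using K[OF that(2)] unfolding cost_def[of N n] by (simp add: mult_ac)
  qed
  \<comment> \<open>\<open>n0\<close> is inserted for the case \<open>K \<le> n0\<close>, where the interval is empty\<close>
  define S where "S = insert n0 {n0..<K}"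
  have "finite S" "S \<noteq> {}" by (auto simp: S_def)
  then obtain n where n: "n \<in> S" "\<And>k. k \<in> S \<Longrightarrow> cost N n \<le> cost N k"
    using ex_is_arg_min_if_finite[of S "cost N"] by (auto simp: is_arg_min_linorder)
  have "cost N n \<le> cost N k" if "n0 \<le> k" for k
  proof (cases "k < K")
    case True
    with n that show ?thesis by (auto simp: S_def)
  next
    case False
    with tail[of k] that n(2)[of n0] show ?thesis by (auto simp: S_def)
  qed
  with n(1) show ?thesis by (auto simp: S_def)
qed

context
  fixes nN :: "real \<Rightarrow> nat"
  assumes nN_ge: "\<And>N. 0 < N \<Longrightarrow> n0 \<le> nN N"
    and nN_min: "\<And>N n. 0 < N \<Longrightarrow> n0 \<le> n \<Longrightarrow> cost N (nN N) \<le> cost N n"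
begin

lemma minimizer_le_candidate: "eventually (\<lambda>N. cost N (nN N) \<le> cost N (candidate N)) at_top"
  using eventually_gt_at_top[of 0] filterlim_at_top[THEN iffD1, OF candidate_at_top, rule_format, of n0]
  by eventually_elim (rule nN_min)

text \<open>
The cost at a given \<open>n\<close> is at least its squared bias, which is positive and does not depend on \<open>N\<close>, whereas the cost of
the competitor tends to 0; so every \<open>n\<close> is eventually excluded.
\<close>

lemma minimizer_at_top: "filterlim nN at_top at_top"
  unfolding filterlim_at_top
proof
  fix K
  define bias where "bias n = B / real n ^ m * (1 + \<delta> n)" for n
  have "0 < bias n" if "n0 \<le> n" for n
    using that B_pos delta_pos[OF that] n0_pos by (simp add: bias_def)
  then have "\<forall>n\<in>{n0..<K}. eventually (\<lambda>N. cost N (candidate N) < bias n) at_top"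
    by (auto intro!: order_tendstoD(2)[OF candidate_cost_0])
  then have "eventually (\<lambda>N. \<forall>n\<in>{n0..<K}. cost N (candidate N) < bias n) at_top"
    by (intro eventually_ball_finite) auto
  with minimizer_le_candidate eventually_gt_at_top[of 0]
  show "eventually (\<lambda>N. K \<le> nN N) at_top"
  proof eventually_elim
    case (elim N)
    have "bias (nN N) \<le> cost N (nN N)"
      using eps_nonneg[OF nN_ge] A_pos elim unfolding cost_def bias_def by simp
    with elim have "nN N \<notin> {n0..<K}" by force
    with nN_ge[of N] elim show ?case by auto
  qed
qed

text \<open>
As minimizers tend to infinity, the cost at a minimizer is bounded below by \<open>q N * \<phi> (u N)\<close>, where \<open>u N\<close> is
the rescaled minimizer and \<open>q N\<close> tends to 1, and it is bounded above by the cost of the competitor.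
This squeezes both the scaled cost and \<open>\<phi> (u N)\<close> to the minimum of \<open>\<phi>\<close>.
\<close>

lemma minimizer_asymptotics:
  shows minimizer_cost: "((\<lambda>N. scale N ^ m * cost N (nN N)) \<longlongrightarrow> \<phi> s\<^sub>0) at_top"
    and minimizer_ratio: "((\<lambda>N. real (nN N) / scale N) \<longlongrightarrow> s\<^sub>0) at_top"
proof -
  define u where "u N = real (nN N) / scale N" for N
  define q where "q N = min (1 + \<epsilon> (nN N)) (1 + \<delta> (nN N))" for N
  have q_lim: "(q \<longlongrightarrow> 1) at_top"
  proof -
    have "((\<lambda>N. \<epsilon> (nN N)) \<longlongrightarrow> 0) at_top" "((\<lambda>N. \<delta> (nN N)) \<longlongrightarrow> 0) at_top"
      using eps_lim delta_lim minimizer_at_top by (auto intro: filterlim_compose)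
    then have "(q \<longlongrightarrow> min (1 + 0) (1 + 0)) at_top"
      unfolding q_def by (intro tendsto_intros)
    then show ?thesis by simp
  qed
  have u_pos: "eventually (\<lambda>N. 0 < u N) at_top"
    using eventually_gt_at_top[of 0]
  proof eventually_elim
    case (elim N)
    with nN_ge[of N] n0_pos scale_pos[of N] show ?case by (simp add: u_def)
  qed
  have lower: "eventually (\<lambda>N. q N * \<phi> (u N) \<le> scale N ^ m * cost N (nN N)) at_top"
    using u_pos eventually_gt_at_top[of 0]
  proof eventually_elim
    case (elim N)
    have "A * u N * q N + B / u N ^ m * q N
        \<le> A * u N * (1 + \<epsilon> (nN N)) + B / u N ^ m * (1 + \<delta> (nN N))"
      using elim A_pos B_pos by (intro add_mono mult_left_mono) (auto simp: q_def)
    also have "\<dots> = scale N ^ m * cost N (nN N)"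
      using elim nN_ge[of N] n0_pos by (subst scaled_cost) (auto simp: u_def)
    finally show ?case by (simp add: leading_cost_def algebra_simps)
  qed
  have upper: "eventually (\<lambda>N. scale N ^ m * cost N (nN N) \<le> scale N ^ m * cost N (candidate N)) at_top"
    using minimizer_le_candidate eventually_gt_at_top[of 0]
    by eventually_elim (intro mult_left_mono zero_le_power less_imp_le[OF scale_pos])
  have q_pos: "eventually (\<lambda>N. 0 < q N) at_top"
    using order_tendstoD(1)[OF q_lim, of 0] by simp
  show cost_lim: "((\<lambda>N. scale N ^ m * cost N (nN N)) \<longlongrightarrow> \<phi> s\<^sub>0) at_top"
  proof (rule tendsto_sandwich[OF _ upper _ candidate_cost])
    show "eventually (\<lambda>N. q N * \<phi> s\<^sub>0 \<le> scale N ^ m * cost N (nN N)) at_top"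
      using lower q_pos u_pos
      by eventually_elim (meson leading_cost_min less_imp_le mult_left_mono order_trans)
    show "((\<lambda>N. q N * \<phi> s\<^sub>0) \<longlongrightarrow> \<phi> s\<^sub>0) at_top"
      using tendsto_mult[OF q_lim tendsto_const] by simp
  qed
  have "((\<lambda>N. \<phi> (u N)) \<longlongrightarrow> \<phi> s\<^sub>0) at_top"
  proof (rule tendsto_sandwich[OF _ _ tendsto_const])
    show "eventually (\<lambda>N. \<phi> s\<^sub>0 \<le> \<phi> (u N)) at_top"
      using u_pos by eventually_elim (rule leading_cost_min)
    show "eventually (\<lambda>N. \<phi> (u N) \<le> scale N ^ m * cost N (nN N) / q N) at_top"
      using lower q_pos by eventually_elim (simp add: field_simps)
    show "((\<lambda>N. scale N ^ m * cost N (nN N) / q N) \<longlongrightarrow> \<phi> s\<^sub>0) at_top"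
      using tendsto_divide[OF cost_lim q_lim] by simp
  qed
  from tendsto_opt_scale[OF u_pos this]
  show "((\<lambda>N. real (nN N) / scale N) \<longlongrightarrow> s\<^sub>0) at_top" by (simp add: u_def[abs_def])
qed

end

end

section \<open>Optimal parameters of the extrapolated estimator\<close>

lemma rr_Theta_tendsto_1: "rr_Theta \<longlonglongrightarrow> 1"
  unfolding rr_Theta_def by real_asymp

lemma rr_opt_scale:
  assumes "1 \<le> R" "0 < V"
  shows "opt_scale (real (R * (R + 1)) / 2 * V) (C\<^sup>2) (2 * R)
       = ((real R + 1) / 4) powr (- 1 / (2 * real R + 1)) * (C\<^sup>2 / V) powr (1 / (2 * real R + 1))"
proof -
  have R: "0 < real R" using assms by simp
  have "real (2 * R) * C\<^sup>2 / (real (R * (R + 1)) / 2 * V)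
      = 2 * real R * C\<^sup>2 / (real R * (real R + 1) / 2 * V)"
    by (simp add: algebra_simps)
  also have "\<dots> = inverse ((real R + 1) / 4) * (C\<^sup>2 / V)"
    using R assms(2) by (simp add: divide_simps)
  finally have base: "real (2 * R) * C\<^sup>2 / (real (R * (R + 1)) / 2 * V) = inverse ((real R + 1) / 4) * (C\<^sup>2 / V)" .
  have "real (2 * R) + 1 = 2 * real R + 1" "- 1 / (2 * real R + 1) = - (1 / (2 * real R + 1))"
    by simp_all
  then show ?thesis
    unfolding opt_scale_def base by (simp only: powr_mult powr_minus inverse_powr)
qed

text \<open>
Both sides are positive products of powers, so it suffices to compare their logarithms. With
\<open>p = 1 / (2 * R + 1)\<close> all the exponents are affine in \<open>p\<close>, and the comparison becomes a linear identity between
the logarithms of the bases. The sum of two powers in \<open>rr_Theta\<close> is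
\<open>(2 * R) powr p * (1 + 1 / (2 * R))\<close>.
\<close>

lemma rr_limit_constant:
  assumes "1 \<le> R" "0 < V" "C \<noteq> 0"
  defines "A \<equiv> real (R * (R + 1)) / 2 * V"
  shows "sqrt (A * opt_scale A (C\<^sup>2) (2 * R) * (1 + 1 / real (2 * R)))
       = 1 / sqrt 2 * rr_Theta R * real R * \<bar>C\<bar> powr (1 / (2 * real R + 1)) * V powr (real R / (2 * real R + 1))"
    (is "sqrt ?L = ?R")
proof -
  define p where "p = 1 / (2 * real R + 1)"
  define l where "l = ln (1 + 1 / (2 * real R))"
  have R: "0 < real R" using assms by simp
  have exps: "1 / (2 * (2 * real R + 1)) = p / 2" "- 1 / (2 * real R + 1) = - p" "1 / (2 * real R + 1) = p"
    "real R / (2 * real R + 1) = (1 - p) / 2" "- 2 * real R / (2 * real R + 1) = p - 1"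
    using R by (auto simp: p_def field_simps)
  have sum: "(2 * real R) powr (p - 1) + (2 * real R) powr p = (2 * real R) powr p * (1 + 1 / (2 * real R))"
    using R by (simp add: powr_diff field_simps)
  have pos: "0 < 1 + 1 / (2 * real R)" "0 < 1 + 1 / real R" "0 < \<bar>C\<bar>" using R assms by (auto intro: add_pos_pos)
  have A: "A = real R * (real R + 1) / 2 * V" by (simp add: A_def algebra_simps)
  have Apos: "0 < A" unfolding A using R assms(2) by simp
  have C2: "C\<^sup>2 = \<bar>C\<bar> ^ 2" by simp
  have s: "opt_scale A (C\<^sup>2) (2 * R) = ((real R + 1) / 4) powr (- p) * (C\<^sup>2 / V) powr p"
    using rr_opt_scale[OF assms(1,2)] unfolding A_def exps .
  have lnC: "ln (C\<^sup>2) = 2 * ln \<bar>C\<bar>"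
    unfolding C2 using pos by (subst ln_realpow) auto
  have ln4: "ln (4::real) = 2 * ln 2" using ln_realpow[of 2 2] by simp
  have lnR1: "ln (1 + 1 / real R) = ln (real R + 1) - ln (real R)"
  proof -
    have "1 + 1 / real R = (real R + 1) / real R" using R by (simp add: field_simps)
    then show ?thesis using R by (simp only:) (simp add: ln_div)
  qed
  have lnA: "ln A = ln (real R) + ln (real R + 1) - ln 2 + ln V"
    unfolding A using R assms(2) by (simp add: ln_mult ln_div)
  have lns: "ln (opt_scale A (C\<^sup>2) (2 * R)) = - p * (ln (real R + 1) - 2 * ln 2) + p * (2 * ln \<bar>C\<bar> - ln V)"
    unfolding s using R assms(2,3) pos lnC ln4 by (simp add: ln_mult ln_powr ln_div)
  have spos: "0 < opt_scale A (C\<^sup>2) (2 * R)"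
    unfolding s using R assms(2,3) by simp
  have lnL: "ln ?L = ln A + ln (opt_scale A (C\<^sup>2) (2 * R)) + l"
    using Apos spos pos by (simp add: ln_mult l_def)
  have Lpos: "0 < ?L" using Apos spos pos by simp
  have Theta: "rr_Theta R = 2 powr (p / 2) * real R powr (- p) * (1 + 1 / real R) powr ((1 - p) / 2)
      * ((2 * real R) powr p * (1 + 1 / (2 * real R))) powr (1 / 2)"
    unfolding rr_Theta_def exps sum ..
  have Theta_pos: "0 < rr_Theta R" using R pos by (simp add: Theta)
  have ln_Theta: "ln (rr_Theta R) = p / 2 * ln 2 - p * ln (real R)
      + (1 - p) / 2 * (ln (real R + 1) - ln (real R)) + 1 / 2 * (p * (ln 2 + ln (real R)) + l)"
    using R pos by (simp add: Theta ln_mult ln_powr lnR1 l_def)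
  have Rpos: "0 < ?R" using R assms(2,3) pos Theta_pos by simp
  have "ln ?R = - ln 2 / 2 + ln (rr_Theta R) + ln (real R) + p * ln \<bar>C\<bar> + (1 - p) / 2 * ln V"
    using R assms(2,3) pos Theta_pos unfolding exps by (simp add: ln_mult ln_div ln_sqrt ln_powr)
  also have "\<dots> = ln ?L / 2"
    unfolding ln_Theta lnL lnA lns by (simp add: field_simps)
  also have "\<dots> = ln (sqrt ?L)"
    using Lpos by (simp add: ln_sqrt)
  finally show ?thesis
    using Lpos Rpos by (metis ln_inj_iff real_sqrt_gt_zero)
qed

text \<open>
The constraint determines \<open>M\<close> from \<open>n\<close>, which turns the squared error into the cost function of
\<open>discretization_tradeoff\<close> with \<open>m = 2 * R\<close>.
\<close>

lemma rr_minimization: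
  fixes \<epsilon> \<delta> :: "nat \<Rightarrow> real"
  assumes R: "1 \<le> R" and V: "0 < V" and C: "C \<noteq> 0" and n0: "1 \<le> n0"
    and "\<epsilon> \<longlonglongrightarrow> 0" and "\<delta> \<longlonglongrightarrow> 0"
    and "\<And>n. n0 \<le> n \<Longrightarrow> 0 \<le> 1 + \<epsilon> n" and "\<And>n. n0 \<le> n \<Longrightarrow> 0 < 1 + \<delta> n"
  shows rr_minimizer_exists:
      "\<And>N. 0 < N \<Longrightarrow> \<exists>p. is_arg_min (rr_error R V C \<epsilon> \<delta>) (\<lambda>p. p \<in> rr_feasible R n0 N) p"
    and rr_min_error_limit:
      "((\<lambda>N. N powr (1 / 2 * (1 - 1 / (2 * real R + 1))) * rr_min_error R n0 V C \<epsilon> \<delta> N)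
           \<longlongrightarrow> 1 / sqrt 2 * rr_Theta R * real R * \<bar>C\<bar> powr (1 / (2 * real R + 1))
               * V powr (real R / (2 * real R + 1))) at_top"
    and rr_minimizer_asymptotics:
      "\<And>nN MN. (\<And>N. 0 < N \<Longrightarrow>
           is_arg_min (rr_error R V C \<epsilon> \<delta>) (\<lambda>p. p \<in> rr_feasible R n0 N) (nN N, MN N)) \<Longrightarrow>
           MN \<sim>[at_top] (\<lambda>N. 2 / (real R * (real R + 1))
               * ((real R + 1) / 4) powr (1 / (2 * real R + 1))
               * (V / C\<^sup>2) powr (1 / (2 * real R + 1)) * N powr (2 * real R / (2 * real R + 1))) \<and>
           (\<lambda>N. real (nN N)) \<sim>[at_top] (\<lambda>N. ((real R + 1) / 4) powr (- 1 / (2 * real R + 1))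
               * (C\<^sup>2 / V) powr (1 / (2 * real R + 1)) * N powr (1 / (2 * real R + 1))) \<and>
           MN \<sim>[at_top] (\<lambda>N. 1 / (2 * real R) * (V / C\<^sup>2) * real (nN N) ^ (2 * R))"
proof -
  define \<kappa> where "\<kappa> = real (R * (R + 1)) / 2"
  have \<kappa>: "0 < \<kappa>" using R by (simp add: \<kappa>_def del: of_nat_mult of_nat_add)
  interpret discretization_tradeoff "\<kappa> * V" "C\<^sup>2" "2 * R" n0 \<epsilon> \<delta>
    by unfold_locales (use assms \<kappa> in auto)
  have scale_eq: "scale N = N powr (1 / (2 * real R + 1))" for N
    by (simp add: scale_def)
  have scale_pow: "scale N ^ (2 * R) = N powr (2 * real R / (2 * real R + 1))" if "0 < N" for N
    using powr_realpow[OF scale_pos[OF that], of "2 * R"] by (simp add: scale_eq powr_powr)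
  have feasible: "rr_feasible R n0 N = (\<lambda>n. (n, N / (\<kappa> * real n))) ` {n0..}" if "0 < N" for N
    using that \<kappa> n0 unfolding rr_feasible_def \<kappa>_def[symmetric] by (auto simp: field_simps)
  have error: "rr_error R V C \<epsilon> \<delta> (n, N / (\<kappa> * real n)) = sqrt (cost N n)" for N n
    unfolding rr_error_def cost_def by (simp add: mult_ac)
  have arg_min: "is_arg_min (rr_error R V C \<epsilon> \<delta>) (\<lambda>p. p \<in> rr_feasible R n0 N) (n, M)
      \<longleftrightarrow> n0 \<le> n \<and> M = N / (\<kappa> * real n) \<and> (\<forall>k\<ge>n0. cost N n \<le> cost N k)" if "0 < N" for N n M
  proof -
    have ball: "(\<forall>p. p \<in> g ` {n0..} \<longrightarrow> Q p) \<longleftrightarrow> (\<forall>k\<ge>n0. Q (g k))" for g :: "nat \<Rightarrow> nat \<times> real" and Q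
      by blast
    show ?thesis
      unfolding is_arg_min_linorder feasible[OF that] ball by (auto simp: error)
  qed
  show "\<exists>p. is_arg_min (rr_error R V C \<epsilon> \<delta>) (\<lambda>p. p \<in> rr_feasible R n0 N) p" if "0 < N" for N
    using minimizer_exists[OF that] arg_min[OF that] by blast

  have "\<forall>N. \<exists>n. 0 < N \<longrightarrow> n0 \<le> n \<and> (\<forall>k\<ge>n0. cost N n \<le> cost N k)"
    using minimizer_exists by blast
  then obtain n where n: "\<And>N. 0 < N \<Longrightarrow> n0 \<le> n N" "\<And>N k. 0 < N \<Longrightarrow> n0 \<le> k \<Longrightarrow> cost N (n N) \<le> cost N k"
    by metis
  have min_error: "rr_min_error R n0 V C \<epsilon> \<delta> N = sqrt (cost N (n N))" if "0 < N" for N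
    unfolding rr_min_error_def feasible[OF that] image_image error
    by (rule cInf_eq_minimum) (use n that in auto)
  have limit: "((\<lambda>N. sqrt (scale N ^ (2 * R) * cost N (n N))) \<longlongrightarrow> sqrt (\<phi> s\<^sub>0)) at_top"
    by (intro tendsto_real_sqrt minimizer_cost n)
  have const: "sqrt (\<phi> s\<^sub>0) = 1 / sqrt 2 * rr_Theta R * real R * \<bar>C\<bar> powr (1 / (2 * real R + 1))
               * V powr (real R / (2 * real R + 1))"
    unfolding leading_cost_min_value unfolding \<kappa>_def by (rule rr_limit_constant[OF R V C])
  have ev: "eventually (\<lambda>N. sqrt (scale N ^ (2 * R) * cost N (n N))
      = N powr (1 / 2 * (1 - 1 / (2 * real R + 1))) * rr_min_error R n0 V C \<epsilon> \<delta> N) at_top"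
    using eventually_gt_at_top[of 0]
  proof eventually_elim
    case (elim N)
    have "1 / 2 * (1 - 1 / (2 * real R + 1)) = 2 * real R / (2 * real R + 1) * (1 / 2)"
      by (simp add: field_simps)
    then have "N powr (1 / 2 * (1 - 1 / (2 * real R + 1))) = sqrt (scale N ^ (2 * R))"
      unfolding scale_pow[OF elim] by (simp only: powr_powr[symmetric] powr_half_sqrt powr_ge_zero)
    then show ?case by (simp add: min_error[OF elim] real_sqrt_mult)
  qed
  show "((\<lambda>N. N powr (1 / 2 * (1 - 1 / (2 * real R + 1))) * rr_min_error R n0 V C \<epsilon> \<delta> N)
           \<longlongrightarrow> 1 / sqrt 2 * rr_Theta R * real R * \<bar>C\<bar> powr (1 / (2 * real R + 1))
               * V powr (real R / (2 * real R + 1))) at_top"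
    using Lim_transform_eventually[OF limit ev] unfolding const .

  fix nN :: "real \<Rightarrow> nat" and MN :: "real \<Rightarrow> real"
  assume "\<And>N. 0 < N \<Longrightarrow> is_arg_min (rr_error R V C \<epsilon> \<delta>) (\<lambda>p. p \<in> rr_feasible R n0 N) (nN N, MN N)"
  then have nN: "\<And>N. 0 < N \<Longrightarrow> n0 \<le> nN N" "\<And>N k. 0 < N \<Longrightarrow> n0 \<le> k \<Longrightarrow> cost N (nN N) \<le> cost N k"
    and MN: "\<And>N. 0 < N \<Longrightarrow> MN N = N / (\<kappa> * real (nN N))"
    using arg_min by auto
  have ratio: "((\<lambda>N. real (nN N) / scale N) \<longlongrightarrow> s\<^sub>0) at_top"
    by (rule minimizer_ratio[OF nN])
  have s0: "s\<^sub>0 = ((real R + 1) / 4) powr (- 1 / (2 * real R + 1)) * (C\<^sup>2 / V) powr (1 / (2 * real R + 1))"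
    unfolding \<kappa>_def by (rule rr_opt_scale[OF R V])
  have inv_s0: "1 / (\<kappa> * s\<^sub>0) = 2 / (real R * (real R + 1)) * ((real R + 1) / 4) powr (1 / (2 * real R + 1))
      * (V / C\<^sup>2) powr (1 / (2 * real R + 1))"
  proof -
    define p where "p = 1 / (2 * real R + 1)"
    have neg: "- 1 / (2 * real R + 1) = - p" by (simp add: p_def)
    have VC: "(V / C\<^sup>2) powr p = inverse ((C\<^sup>2 / V) powr p)"
      unfolding inverse_powr[symmetric] by simp
    have "1 / (\<kappa> * s\<^sub>0) = 1 / \<kappa> * ((real R + 1) / 4) powr p * inverse ((C\<^sup>2 / V) powr p)"
      unfolding s0 neg p_def[symmetric] powr_minus by (simp add: field_simps)
    also have "1 / \<kappa> = 2 / (real R * (real R + 1))"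
      by (simp add: \<kappa>_def algebra_simps)
    finally show ?thesis unfolding VC[symmetric] unfolding p_def .
  qed
  have nN_pos: "0 < real (nN N)" if "0 < N" for N using nN(1)[OF that] n0 by simp

  have "(\<lambda>N. real (nN N)) \<sim>[at_top] (\<lambda>N. s\<^sub>0 * scale N)"
    using opt_scale_pos by (intro asymp_equivI'_const[OF ratio]) simp
  moreover have "MN \<sim>[at_top] (\<lambda>N. 1 / (\<kappa> * s\<^sub>0) * scale N ^ (2 * R))"
  proof (rule asymp_equivI'_const)
    have "((\<lambda>N. 1 / (\<kappa> * (real (nN N) / scale N))) \<longlongrightarrow> 1 / (\<kappa> * s\<^sub>0)) at_top"
      using \<kappa> opt_scale_pos by (intro tendsto_intros ratio) simp
    moreover have "eventually (\<lambda>N. 1 / (\<kappa> * (real (nN N) / scale N)) = MN N / scale N ^ (2 * R)) at_top"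
      using eventually_gt_at_top[of 0]
    proof eventually_elim
      case (elim N)
      then show ?case
        using scale_power[OF elim] scale_pos[OF elim] nN_pos[OF elim] \<kappa>
        by (simp add: MN field_simps)
    qed
    ultimately show "((\<lambda>N. MN N / scale N ^ (2 * R)) \<longlongrightarrow> 1 / (\<kappa> * s\<^sub>0)) at_top"
      by (rule Lim_transform_eventually)
  qed (use \<kappa> opt_scale_pos in auto)
  moreover have "MN \<sim>[at_top] (\<lambda>N. 1 / (2 * real R) * (V / C\<^sup>2) * real (nN N) ^ (2 * R))"
  proof (rule asymp_equivI'_const)
    have limit: "((\<lambda>N. 1 / (\<kappa> * (real (nN N) / scale N) ^ (2 * R + 1))) \<longlongrightarrow> 1 / (\<kappa> * s\<^sub>0 ^ (2 * R + 1))) at_top"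
      using \<kappa> opt_scale_pos by (intro tendsto_intros ratio) simp
    have const: "1 / (\<kappa> * s\<^sub>0 ^ (2 * R + 1)) = 1 / (2 * real R) * (V / C\<^sup>2)"
      unfolding opt_scale_power using \<kappa> R V C by (simp add: field_simps)
    have ev: "eventually (\<lambda>N. 1 / (\<kappa> * (real (nN N) / scale N) ^ (2 * R + 1))
        = MN N / real (nN N) ^ (2 * R)) at_top"
      using eventually_gt_at_top[of 0]
    proof eventually_elim
      case (elim N)
      then show ?case
        using scale_pos[OF elim] nN_pos[OF elim] \<kappa>
        by (simp only: MN power_divide scale_power) (simp add: field_simps)
    qed
    show "((\<lambda>N. MN N / real (nN N) ^ (2 * R)) \<longlongrightarrow> 1 / (2 * real R) * (V / C\<^sup>2)) at_top"
      using Lim_transform_eventually[OF limit ev] unfolding const .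
  qed (use R V C in auto)
  moreover have "(\<lambda>N. 1 / (\<kappa> * s\<^sub>0) * scale N ^ (2 * R)) \<sim>[at_top]
      (\<lambda>N. 1 / (\<kappa> * s\<^sub>0) * N powr (2 * real R / (2 * real R + 1)))"
    by (intro asymp_equiv_refl_ev eventually_mono[OF eventually_gt_at_top[of 0]]) (simp add: scale_pow)
  ultimately show "MN \<sim>[at_top] (\<lambda>N. 2 / (real R * (real R + 1))
               * ((real R + 1) / 4) powr (1 / (2 * real R + 1))
               * (V / C\<^sup>2) powr (1 / (2 * real R + 1)) * N powr (2 * real R / (2 * real R + 1))) \<and>
           (\<lambda>N. real (nN N)) \<sim>[at_top] (\<lambda>N. ((real R + 1) / 4) powr (- 1 / (2 * real R + 1))
               * (C\<^sup>2 / V) powr (1 / (2 * real R + 1)) * N powr (1 / (2 * real R + 1))) \<and>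
           MN \<sim>[at_top] (\<lambda>N. 1 / (2 * real R) * (V / C\<^sup>2) * real (nN N) ^ (2 * R))"
    unfolding inv_s0 unfolding s0 scale_eq by (blast intro: asymp_equiv_trans)
qed

theorem mainTheorem6:
  fixes P :: "'w measure" and F :: "real \<Rightarrow> 'w measure"
    and W :: "real \<Rightarrow> 'w \<Rightarrow> real ^ 'q" and X :: "real \<Rightarrow> 'w \<Rightarrow> real ^ 'd"
    and b :: "real \<Rightarrow> real ^ 'd \<Rightarrow> real ^ 'd" and \<sigma> :: "real \<Rightarrow> real ^ 'd \<Rightarrow> real ^ 'q ^ 'd"
    and x :: "real ^ 'd" and f :: "real ^ 'd \<Rightarrow> real" and c :: "nat \<Rightarrow> real"
    and T V C :: real and R n0 :: nat and \<epsilon> \<delta> :: "nat \<Rightarrow> real"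
  defines "V \<equiv> prob_space.variance P (\<lambda>\<omega>. f (X T \<omega>))"
    and "C \<equiv> rr_const c R"
  assumes "0 < T" and "2 \<le> R"
    and "prob_space P"
    and "brownian_motion T P F W"
    and "(\<lambda>(t, y). b t y) \<in> borel_measurable borel"
    and "(\<lambda>(t, y). \<sigma> t y) \<in> borel_measurable borel"
    and "f \<in> borel_measurable borel"
    and "sde_solution T P F W b \<sigma> x X"
    and "integrable P (\<lambda>\<omega>. (f (X T \<omega>))\<^sup>2)"
    and "\<And>k. 1 \<le> k \<Longrightarrow> integrable P (\<lambda>\<omega>. (f (euler_terminal T W b \<sigma> x k \<omega>))\<^sup>2)"
    and weak_error_expansion:
      "(\<lambda>n. prob_space.expectation P (\<lambda>\<omega>. f (X T \<omega>))
          - prob_space.expectation P (\<lambda>\<omega>. f (euler_terminal T W b \<sigma> x n \<omega>))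
          - (\<Sum>k=1..R. c k / real n ^ k)) \<in> O(\<lambda>n. 1 / real n ^ (R + 1))"
    and variance_convergence:
      "(\<lambda>n. prob_space.variance P (rr_payoff T W b \<sigma> x f R n)) \<longlonglongrightarrow> V"
    and "0 < V" and "C \<noteq> 0"
    and sq_error:
      "\<And>n M. 1 \<le> n \<Longrightarrow> 1 \<le> M \<Longrightarrow>
         mc_sq_error P (prob_space.expectation P (\<lambda>\<omega>. f (X T \<omega>))) (rr_payoff T W b \<sigma> x f R n) M
         = V / real M * (1 + \<epsilon> n) + C\<^sup>2 / real n ^ (2 * R) * (1 + \<delta> n)"
    and "1 \<le> n0"
    and bias_nonzero:
      "\<And>n. n0 \<le> n \<Longrightarrow> prob_space.expectation P (rr_payoff T W b \<sigma> x f R n)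
                     \<noteq> prob_space.expectation P (\<lambda>\<omega>. f (X T \<omega>))"
  shows "\<epsilon> \<longlonglongrightarrow> 0 \<and> \<delta> \<in> O(\<lambda>n. 1 / real n) \<and>
    (\<forall>N>0. \<exists>p. is_arg_min (rr_error R V C \<epsilon> \<delta>) (\<lambda>p. p \<in> rr_feasible R n0 N) p) \<and>
    ((\<lambda>N. N powr (1 / 2 * (1 - 1 / (2 * real R + 1))) * rr_min_error R n0 V C \<epsilon> \<delta> N)
           \<longlongrightarrow> 1 / sqrt 2 * rr_Theta R * real R * \<bar>C\<bar> powr (1 / (2 * real R + 1))
               * V powr (real R / (2 * real R + 1))) at_top \<and>
    rr_Theta \<longlonglongrightarrow> 1 \<and>
    (\<forall>nN MN.
           (\<forall>N>0. is_arg_min (rr_error R V C \<epsilon> \<delta>) (\<lambda>p. p \<in> rr_feasible R n0 N) (nN N, MN N)) \<longrightarrow>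
           MN \<sim>[at_top] (\<lambda>N. 2 / (real R * (real R + 1))
               * ((real R + 1) / 4) powr (1 / (2 * real R + 1))
               * (V / C\<^sup>2) powr (1 / (2 * real R + 1)) * N powr (2 * real R / (2 * real R + 1))) \<and>
           (\<lambda>N. real (nN N)) \<sim>[at_top] (\<lambda>N. ((real R + 1) / 4) powr (- 1 / (2 * real R + 1))
               * (C\<^sup>2 / V) powr (1 / (2 * real R + 1)) * N powr (1 / (2 * real R + 1))) \<and>
           MN \<sim>[at_top] (\<lambda>N. 1 / (2 * real R) * (V / C\<^sup>2) * real (nN N) ^ (2 * R)))"
proof -
  interpret prob_space P by fact
  define a where "a = expectation (\<lambda>\<omega>. f (X T \<omega>))"
  define Z where "Z = rr_payoff T W b \<sigma> x f R"
  define g where "g k = (\<lambda>\<omega>. f (euler_terminal T W b \<sigma> x k \<omega>))" for k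
  define \<beta> where "\<beta> n = a - expectation (Z n)" for n
  have Z_eq: "Z n = (\<lambda>\<omega>. \<Sum>r=1..R. rr_weight R r * g (r * n) \<omega>)" for n
    by (simp add: Z_def g_def rr_payoff_def fun_eq_iff)

  have W_meas: "W t \<in> borel_measurable P" if "t \<in> {0..T}" for t
    using \<open>brownian_motion T P F W\<close> that unfolding brownian_motion_def filtered_on_def
    by (metis measurable_from_subalg)
  have g_meas: "g k \<in> borel_measurable P" for k
    unfolding g_def euler_terminal_def
    by (rule measurable_compose[OF borel_measurable_euler \<open>f \<in> borel_measurable borel\<close>])
      (use W_meas \<open>0 < T\<close> assms(7,8) in auto)
  have g_sq: "integrable P (\<lambda>\<omega>. (g k \<omega>)\<^sup>2)" if "1 \<le> k" for k
    unfolding g_def by (rule assms(12)[OF that])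
  have Z_meas: "Z n \<in> borel_measurable P" for n
    unfolding Z_eq using g_meas by (intro borel_measurable_sum borel_measurable_times) auto
  have Z_sq: "integrable P (\<lambda>\<omega>. (Z n \<omega>)\<^sup>2)" if "1 \<le> n" for n
    unfolding Z_eq using that by (intro square_integrable_sum g_meas g_sq) auto

  \<comment> \<open>two expressions that are affine in \<open>1 / M\<close> and agree at \<open>M = 1\<close> and \<open>M = 2\<close> have the same coefficients\<close>
  have split: "variance (Z n) / real M + (\<beta> n)\<^sup>2 = V / real M * (1 + \<epsilon> n) + C\<^sup>2 / real n ^ (2 * R) * (1 + \<delta> n)"
    if "1 \<le> n" "1 \<le> M" for n M
    using sq_error[OF that] mc_sq_error_decomposition[OF \<open>prob_space P\<close> Z_meas Z_sq[OF that(1)] that(2)]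
    unfolding Z_def a_def \<beta>_def by simp
  have var: "variance (Z n) = V * (1 + \<epsilon> n)"
    and sq_bias: "(\<beta> n)\<^sup>2 = C\<^sup>2 / real n ^ (2 * R) * (1 + \<delta> n)" if "1 \<le> n" for n
  proof -
    define v d where "v = V * (1 + \<epsilon> n)" and "d = C\<^sup>2 / real n ^ (2 * R) * (1 + \<delta> n)"
    have "variance (Z n) / 1 + (\<beta> n)\<^sup>2 = v / 1 + d"
      using split[OF that, of 1] unfolding v_def d_def by (simp only: of_nat_1 div_by_1)
    moreover have "variance (Z n) / 2 + (\<beta> n)\<^sup>2 = v / 2 + d"
      using split[OF that, of 2] unfolding v_def d_def by (simp only: of_nat_numeral times_divide_eq_left)
    ultimately show "variance (Z n) = V * (1 + \<epsilon> n)" "(\<beta> n)\<^sup>2 = C\<^sup>2 / real n ^ (2 * R) * (1 + \<delta> n)"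
      unfolding v_def[symmetric] d_def[symmetric] by linarith+
  qed

  have "(\<lambda>n. variance (Z n) / V - 1) \<longlonglongrightarrow> V / V - 1"
    using \<open>0 < V\<close> by (intro tendsto_intros variance_convergence[folded Z_def]) simp
  then have "(\<lambda>n. variance (Z n) / V - 1) \<longlonglongrightarrow> 0"
    using \<open>0 < V\<close> by (simp only: divide_self diff_self less_imp_neq[symmetric] not_False_eq_True)
  moreover have "eventually (\<lambda>n. variance (Z n) / V - 1 = \<epsilon> n) sequentially"
    using eventually_ge_at_top[of 1] by eventually_elim (use \<open>0 < V\<close> in \<open>simp only: var, simp\<close>)
  ultimately have eps: "\<epsilon> \<longlonglongrightarrow> 0"
    by (rule Lim_transform_eventually)

  \<comment> \<open>the weights sum to 1, so the bias of the combination is the combination of the biases\<close>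
  have bias_eq: "\<beta> n = (\<Sum>r=1..R. rr_weight R r * (a - expectation (g (r * n))))" if "1 \<le> n" for n
  proof -
    have "integrable P (g (r * n))" if "r \<in> {1..R}" for r
      by (rule square_integrable_imp_integrable[OF g_meas g_sq]) (use that \<open>1 \<le> n\<close> in auto)
    then have "expectation (Z n) = (\<Sum>r=1..R. rr_weight R r * expectation (g (r * n)))"
      unfolding Z_eq by (subst Bochner_Integration.integral_sum) auto
    moreover have "(\<Sum>r=1..R. rr_weight R r) = 1"
      using rr_weight_moment[of 0 R] \<open>2 \<le> R\<close> by simp
    ultimately show ?thesis
      by (simp add: \<beta>_def right_diff_distrib sum_subtractf flip: sum_distrib_right)
  qed
  have "eventually (\<lambda>n. (\<Sum>r=1..R. rr_weight R r * (a - expectation (g (r * n)))) - C / real n ^ R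
      = \<beta> n - C / real n ^ R) sequentially"
    using eventually_ge_at_top[of 1] by eventually_elim (simp only: bias_eq)
  moreover have "(\<lambda>n. (\<Sum>r=1..R. rr_weight R r * (a - expectation (g (r * n)))) - C / real n ^ R)
      \<in> O(\<lambda>n. 1 / real n ^ (R + 1))"
    unfolding C_def using weak_error_expansion \<open>2 \<le> R\<close> unfolding a_def g_def
    by (intro rr_bias_expansion) auto
  ultimately have bias: "(\<lambda>n. \<beta> n - C / real n ^ R) \<in> O(\<lambda>n. 1 / real n ^ (R + 1))"
    by (simp only: landau_o.big.in_cong)
  have delta: "\<delta> \<in> O(\<lambda>n. 1 / real n)"
    by (rule relative_sq_bias_bigo[OF \<open>C \<noteq> 0\<close> bias sq_bias])
  have delta_lim: "\<delta> \<longlonglongrightarrow> 0"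
  proof -
    have "(\<lambda>n. 1 / real n) \<in> o(\<lambda>_. 1)"
      by (rule smalloI_tendsto) (auto intro: lim_1_over_n)
    with delta have "\<delta> \<in> o(\<lambda>_. 1)" by (rule landau_o.big_small_trans)
    from smalloD_tendsto[OF this] show ?thesis by simp
  qed

  have eps_nonneg: "0 \<le> 1 + \<epsilon> n" if "n0 \<le> n" for n
  proof -
    have "0 \<le> V * (1 + \<epsilon> n)"
      using variance_positive[of "Z n"] var[of n] \<open>1 \<le> n0\<close> that by simp
    then show ?thesis using \<open>0 < V\<close> by (simp add: zero_le_mult_iff)
  qed
  have delta_pos: "0 < 1 + \<delta> n" if "n0 \<le> n" for n
  proof -
    have "0 < (\<beta> n)\<^sup>2"
      using bias_nonzero[OF that] by (simp add: \<beta>_def a_def Z_def)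
    then have "0 < C\<^sup>2 / real n ^ (2 * R) * (1 + \<delta> n)"
      using sq_bias[of n] \<open>1 \<le> n0\<close> that by simp
    moreover have "0 < C\<^sup>2 / real n ^ (2 * R)"
      using \<open>C \<noteq> 0\<close> \<open>1 \<le> n0\<close> that by simp
    ultimately show ?thesis by (rule zero_less_mult_pos)
  qed
  have "1 \<le> R" using \<open>2 \<le> R\<close> by simp
  note minimization = \<open>1 \<le> R\<close> \<open>0 < V\<close> \<open>C \<noteq> 0\<close> \<open>1 \<le> n0\<close> eps delta_lim eps_nonneg delta_pos
  show ?thesis
  proof (intro conjI)
    show "\<forall>N>0. \<exists>p. is_arg_min (rr_error R V C \<epsilon> \<delta>) (\<lambda>p. p \<in> rr_feasible R n0 N) p"
      using rr_minimizer_exists[OF minimization] by blast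
  qed (intro allI impI eps delta rr_Theta_tendsto_1 rr_min_error_limit[OF minimization]
      rr_minimizer_asymptotics[OF minimization]; blast)+
qed

end
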